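(* Let $\mathcal M$ be a von Neumann algebra, let $\mathcal B$ be a dual Banach algebra with predual $\mathcal B_*$, and let $\theta:\mathcal M\to\mathcal B$ be a Banach algebra isomorphism (a bounded bijective algebra homomorphism). Then $\theta$ is weak$^*$-continuous, that is, continuous from $\sigma(\mathcal M,\mathcal M_* )$ to $\sigma(\mathcal B,\mathcal B_* )$, where $\mathcal M_*$ is the usual von Neumann algebra predual of $\mathcal M$.
   Context: A dual Banach algebra with predual $\mathcal B_*$ is a Banach algebra $\mathcal B$ which is isomorphic as a Banach space (not necessarily isometrically) to the dual of the Banach space $\mathcal B_*$, such that the product of $\mathcal B$ is separately continuous in the resulting weak$^*$-topology $\sigma(\mathcal B,\mathcal B_* )$. The map $\theta$ is not assumed to be isometric or $*$-preserving. *)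

theory Defs
  imports "HOL-Analysis.Analysis"
begin

text \<open>
  HOL-Analysis only provides real normed spaces and real inner products. All spaces and
  algebras here are complex, so the complex structure is added on top of the real classes.
\<close>

class scaleC =
  fixes scaleC :: "complex \<Rightarrow> 'a \<Rightarrow> 'a"  (infixr "*\<^sub>C" 75)

class complex_normed_vector = real_normed_vector + scaleC +
  assumes scaleR_scaleC: "scaleR r x = complex_of_real r *\<^sub>C x"
    and scaleC_add_right: "a *\<^sub>C (x + y) = a *\<^sub>C x + a *\<^sub>C y"
    and scaleC_add_left: "(a + b) *\<^sub>C x = a *\<^sub>C x + b *\<^sub>C x"
    and scaleC_scaleC: "a *\<^sub>C b *\<^sub>C x = (a * b) *\<^sub>C x"
    and norm_scaleC: "norm (a *\<^sub>C x) = cmod a * norm x"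

class complex_banach = complex_normed_vector + complete_space

subclass (in complex_banach) banach ..

text \<open>No unit is required.\<close>

class complex_banach_algebra = complex_banach + real_normed_algebra +
  assumes scaleC_mult_left: "(a *\<^sub>C x) * y = a *\<^sub>C (x * y)"
    and scaleC_mult_right: "x * (a *\<^sub>C y) = a *\<^sub>C (x * y)"

text \<open>The inner product is linear in its first argument.\<close>

class complex_hilbert = complex_banach +
  fixes cinner :: "'a \<Rightarrow> 'a \<Rightarrow> complex"
  assumes cinner_add_left: "cinner (x + y) z = cinner x z + cinner y z"
    and cinner_scaleC_left: "cinner (a *\<^sub>C x) y = a * cinner x y"
    and cinner_commute: "cinner x y = cnj (cinner y x)"
    and cinner_self: "cinner x x = complex_of_real ((norm x)\<^sup>2)"

instantiation complex :: complex_hilbert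
begin

definition scaleC_complex :: "complex \<Rightarrow> complex \<Rightarrow> complex"
  where "scaleC_complex a x = a * x"

definition cinner_complex :: "complex \<Rightarrow> complex \<Rightarrow> complex"
  where "cinner_complex x y = x * cnj y"

instance
  by standard
    (auto simp: scaleC_complex_def cinner_complex_def scaleR_conv_of_real algebra_simps
      norm_mult complex_norm_square simp del: of_real_power)

end

definition bounded_clinear :: "('a::complex_normed_vector \<Rightarrow> 'b::complex_normed_vector) \<Rightarrow> bool"
  where "bounded_clinear f \<longleftrightarrow> bounded_linear f \<and> (\<forall>a x. f (a *\<^sub>C x) = a *\<^sub>C f x)"


subsection \<open>Bounded complex-linear operators\<close>

typedef (overloaded) ('a, 'b) cblinfun ("(_ \<Rightarrow>\<^sub>C\<^sub>L /_)" [22, 21] 21) =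
  "{f :: 'a::complex_normed_vector \<Rightarrow>\<^sub>L 'b::complex_normed_vector.
     \<forall>a x. blinfun_apply f (a *\<^sub>C x) = a *\<^sub>C blinfun_apply f x}"
  by (rule exI[of _ 0]) (auto, metis norm_eq_zero norm_scaleC mult_zero_right norm_zero)

setup_lifting type_definition_cblinfun

lift_definition cblinfun_apply :: "'a::complex_normed_vector \<Rightarrow>\<^sub>C\<^sub>L 'b::complex_normed_vector \<Rightarrow> 'a \<Rightarrow> 'b"
  (infixl "*\<^sub>V" 95) is blinfun_apply .

lemma bounded_clinear_cblinfun_apply: "bounded_clinear (cblinfun_apply f)"
  unfolding bounded_clinear_def
  by transfer (auto intro: blinfun.bounded_linear_right)

lemma cblinfun_eqI: "(\<And>x. f *\<^sub>V x = g *\<^sub>V x) \<Longrightarrow> f = g"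
  by transfer (rule blinfun_eqI)

lemma scaleC_zero_right: "a *\<^sub>C 0 = (0::'a::complex_normed_vector)"
  by (metis norm_eq_zero norm_scaleC mult_zero_right norm_zero)

lemma scaleC_minus_right: "a *\<^sub>C (- x) = - (a *\<^sub>C (x::'a::complex_normed_vector))"
  by (metis scaleC_add_right scaleC_zero_right add_eq_0_iff add.right_inverse)

lemma scaleC_diff_right:
  "a *\<^sub>C (x - y) = a *\<^sub>C x - a *\<^sub>C (y::'a::complex_normed_vector)"
  by (metis scaleC_add_right scaleC_minus_right diff_conv_add_uminus)

lemma bounded_linear_scaleC: "bounded_linear (\<lambda>x::'a::complex_normed_vector. a *\<^sub>C x)"
  by (rule bounded_linear_intro[where K = "cmod a"])
    (auto simp: scaleC_add_right scaleR_scaleC scaleC_scaleC norm_scaleC mult.commute)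

lift_definition blinfun_scaleC ::
  "complex \<Rightarrow> 'a::real_normed_vector \<Rightarrow>\<^sub>L 'b::complex_normed_vector \<Rightarrow> 'a \<Rightarrow>\<^sub>L 'b"
  is "\<lambda>a f x. a *\<^sub>C f x"
  by (rule bounded_linear_compose[OF bounded_linear_scaleC])

lemma norm_blinfun_scaleC_le: "norm (blinfun_scaleC a f) \<le> cmod a * norm f"
  by (rule norm_blinfun_bound)
    (auto simp: blinfun_scaleC.rep_eq norm_scaleC mult.assoc intro!: mult_left_mono norm_blinfun)

lemma norm_blinfun_scaleC: "norm (blinfun_scaleC a f) = cmod a * norm f"
proof (cases "a = 0")
  case True
  then show ?thesis
    using norm_blinfun_scaleC_le[of a f] by (simp add: order_antisym)
next
  case False
  have "blinfun_scaleC (inverse a) (blinfun_scaleC a f) = f"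
  proof (rule blinfun_eqI)
    fix x
    have "1 *\<^sub>C y = y" for y :: 'b
      using scaleR_scaleC[of 1 y] by simp
    then show "blinfun_scaleC (inverse a) (blinfun_scaleC a f) x = f x"
      using False by (simp add: blinfun_scaleC.rep_eq scaleC_scaleC)
  qed
  then have "norm f \<le> inverse (cmod a) * norm (blinfun_scaleC a f)"
    using norm_blinfun_scaleC_le[of "inverse a" "blinfun_scaleC a f"] by (simp add: norm_inverse)
  then have "cmod a * norm f \<le> norm (blinfun_scaleC a f)"
    using False by (simp add: field_simps)
  then show ?thesis
    using norm_blinfun_scaleC_le[of a f] by (simp add: order_antisym)
qed

instantiation cblinfun :: (complex_normed_vector, complex_normed_vector) complex_normed_vector
begin

lift_definition zero_cblinfun :: "'a \<Rightarrow>\<^sub>C\<^sub>L 'b" is 0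
  by (simp add: scaleC_zero_right)

lift_definition plus_cblinfun :: "'a \<Rightarrow>\<^sub>C\<^sub>L 'b \<Rightarrow> 'a \<Rightarrow>\<^sub>C\<^sub>L 'b \<Rightarrow> 'a \<Rightarrow>\<^sub>C\<^sub>L 'b" is "(+)"
  by (simp add: blinfun.bilinear_simps scaleC_add_right)

lift_definition minus_cblinfun :: "'a \<Rightarrow>\<^sub>C\<^sub>L 'b \<Rightarrow> 'a \<Rightarrow>\<^sub>C\<^sub>L 'b \<Rightarrow> 'a \<Rightarrow>\<^sub>C\<^sub>L 'b" is "(-)"
  by (simp add: blinfun.bilinear_simps scaleC_diff_right)

lift_definition uminus_cblinfun :: "'a \<Rightarrow>\<^sub>C\<^sub>L 'b \<Rightarrow> 'a \<Rightarrow>\<^sub>C\<^sub>L 'b" is uminus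
  by (simp add: blinfun.bilinear_simps scaleC_minus_right)

lift_definition scaleR_cblinfun :: "real \<Rightarrow> 'a \<Rightarrow>\<^sub>C\<^sub>L 'b \<Rightarrow> 'a \<Rightarrow>\<^sub>C\<^sub>L 'b" is scaleR
  by (simp add: blinfun.bilinear_simps scaleR_scaleC scaleC_scaleC mult.commute)

lift_definition scaleC_cblinfun :: "complex \<Rightarrow> 'a \<Rightarrow>\<^sub>C\<^sub>L 'b \<Rightarrow> 'a \<Rightarrow>\<^sub>C\<^sub>L 'b" is blinfun_scaleC
  by (simp add: blinfun_scaleC.rep_eq scaleC_scaleC mult.commute)

lift_definition norm_cblinfun :: "'a \<Rightarrow>\<^sub>C\<^sub>L 'b \<Rightarrow> real" is norm .

lift_definition dist_cblinfun :: "'a \<Rightarrow>\<^sub>C\<^sub>L 'b \<Rightarrow> 'a \<Rightarrow>\<^sub>C\<^sub>L 'b \<Rightarrow> real" is dist .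

lift_definition sgn_cblinfun :: "'a \<Rightarrow>\<^sub>C\<^sub>L 'b \<Rightarrow> 'a \<Rightarrow>\<^sub>C\<^sub>L 'b" is sgn
  by (simp add: sgn_div_norm blinfun.bilinear_simps scaleR_scaleC scaleC_scaleC mult.commute)

definition uniformity_cblinfun :: "(('a \<Rightarrow>\<^sub>C\<^sub>L 'b) \<times> ('a \<Rightarrow>\<^sub>C\<^sub>L 'b)) filter"
  where "uniformity_cblinfun = (INF e\<in>{0<..}. principal {(x, y). dist x y < e})"

definition open_cblinfun :: "('a \<Rightarrow>\<^sub>C\<^sub>L 'b) set \<Rightarrow> bool"
  where "open_cblinfun U = (\<forall>x\<in>U. \<forall>\<^sub>F (x', y) in uniformity. x' = x \<longrightarrow> y \<in> U)"

instance
proof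
  fix f g h :: "'a \<Rightarrow>\<^sub>C\<^sub>L 'b" and a b :: complex and r s :: real
  show "f + g + h = f + (g + h)" "f + g = g + f" "0 + f = f" "- f + f = 0" "f - g = f + - g"
    by (transfer; simp add: algebra_simps)+
  show "r *\<^sub>R (f + g) = r *\<^sub>R f + r *\<^sub>R g" "(r + s) *\<^sub>R f = r *\<^sub>R f + s *\<^sub>R f"
    "r *\<^sub>R s *\<^sub>R f = (r * s) *\<^sub>R f" "1 *\<^sub>R f = f"
    by (transfer; simp add: algebra_simps)+
  show "dist f g = norm (f - g)" "sgn f = inverse (norm f) *\<^sub>R f"
    "(norm f = 0) = (f = 0)" "norm (f + g) \<le> norm f + norm g" "norm (r *\<^sub>R f) = \<bar>r\<bar> * norm f"
    by (transfer; simp add: dist_norm sgn_div_norm norm_triangle_ineq)+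
  show "uniformity = (INF e\<in>{0<..}. principal {(x, y :: 'a \<Rightarrow>\<^sub>C\<^sub>L 'b). dist x y < e})"
    by (rule uniformity_cblinfun_def)
  show "open U = (\<forall>x\<in>U. \<forall>\<^sub>F (x', y) in uniformity. x' = x \<longrightarrow> y \<in> U)"
    for U :: "('a \<Rightarrow>\<^sub>C\<^sub>L 'b) set"
    by (rule open_cblinfun_def)
  show "r *\<^sub>R f = complex_of_real r *\<^sub>C f"
    by transfer (auto intro!: blinfun_eqI
        simp: blinfun.bilinear_simps blinfun_scaleC.rep_eq scaleR_scaleC)
  show "a *\<^sub>C (f + g) = a *\<^sub>C f + a *\<^sub>C g" "(a + b) *\<^sub>C f = a *\<^sub>C f + b *\<^sub>C f"
    "a *\<^sub>C b *\<^sub>C f = (a * b) *\<^sub>C f"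
    by (transfer; auto intro!: blinfun_eqI simp: blinfun.bilinear_simps blinfun_scaleC.rep_eq
        scaleC_add_right scaleC_add_left scaleC_scaleC)+
  show "norm (a *\<^sub>C f) = cmod a * norm f"
    by transfer (rule norm_blinfun_scaleC)
qed

end

lift_definition cblinfun_compose ::
  "'b::complex_normed_vector \<Rightarrow>\<^sub>C\<^sub>L 'c::complex_normed_vector \<Rightarrow> 'a::complex_normed_vector \<Rightarrow>\<^sub>C\<^sub>L 'b \<Rightarrow> 'a \<Rightarrow>\<^sub>C\<^sub>L 'c"
  (infixl "o\<^sub>C\<^sub>L" 67) is blinfun_compose
  by simp


subsection \<open>Weak topologies\<close>

text \<open>
  The coarsest topology on the set \<open>S\<close> making every functional in \<open>F\<close> continuous, i.e. the
  topology \<open>\<sigma>(S, F)\<close>. The set \<open>S\<close> itself is a generator only in order to get the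
  right underlying set when \<open>F\<close> is empty.
\<close>

definition weak_topology :: "'a set \<Rightarrow> ('a \<Rightarrow> complex) set \<Rightarrow> 'a topology"
  where "weak_topology S F =
    topology_generated_by (insert S {f -` U \<inter> S |f U. f \<in> F \<and> open U})"


subsection \<open>Von Neumann algebras\<close>

definition is_adjoint :: "('h::complex_hilbert \<Rightarrow>\<^sub>C\<^sub>L 'h) \<Rightarrow> ('h \<Rightarrow>\<^sub>C\<^sub>L 'h) \<Rightarrow> bool"
  where "is_adjoint x y \<longleftrightarrow> (\<forall>\<xi> \<eta>. cinner (x *\<^sub>V \<xi>) \<eta> = cinner \<xi> (y *\<^sub>V \<eta>))"

definition star_subalgebra :: "('h::complex_hilbert \<Rightarrow>\<^sub>C\<^sub>L 'h) set \<Rightarrow> bool"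
  where "star_subalgebra M \<longleftrightarrow>
    0 \<in> M \<and>
    (\<forall>x\<in>M. \<forall>y\<in>M. x + y \<in> M) \<and>
    (\<forall>a. \<forall>x\<in>M. a *\<^sub>C x \<in> M) \<and>
    (\<forall>x\<in>M. \<forall>y\<in>M. x o\<^sub>C\<^sub>L y \<in> M) \<and>
    (\<forall>x\<in>M. \<exists>y\<in>M. is_adjoint x y)"

definition commutant :: "('h::complex_hilbert \<Rightarrow>\<^sub>C\<^sub>L 'h) set \<Rightarrow> ('h \<Rightarrow>\<^sub>C\<^sub>L 'h) set"
  where "commutant M = {y. \<forall>x\<in>M. x o\<^sub>C\<^sub>L y = y o\<^sub>C\<^sub>L x}"

definition von_neumann_algebra :: "('h::complex_hilbert \<Rightarrow>\<^sub>C\<^sub>L 'h) set \<Rightarrow> bool"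
  where "von_neumann_algebra M \<longleftrightarrow> star_subalgebra M \<and> commutant (commutant M) = M"

text \<open>
  The predual \<open>M\<^sub>*\<close> consists of the normal (ultraweakly continuous) functionals, i.e. those of the
  form \<open>x \<mapsto> \<Sum>n. \<langle>x \<xi>\<^sub>n, \<eta>\<^sub>n\<rangle>\<close> with square-summable sequences of vectors. The series converges
  absolutely by Cauchy-Schwarz. Functionals are HOL functions on all operators, of which only
  the values on \<open>M\<close> matter.
\<close>

definition vn_predual :: "('h::complex_hilbert \<Rightarrow>\<^sub>C\<^sub>L 'h) set \<Rightarrow> (('h \<Rightarrow>\<^sub>C\<^sub>L 'h) \<Rightarrow> complex) set"
  where "vn_predual M = {f. \<exists>\<xi> \<eta> :: nat \<Rightarrow> 'h.
    summable (\<lambda>n. (norm (\<xi> n))\<^sup>2) \<and> summable (\<lambda>n. (norm (\<eta> n))\<^sup>2) \<and>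
    (\<forall>x\<in>M. f x = (\<Sum>n. cinner (x *\<^sub>V \<xi> n) (\<eta> n)))}"


subsection \<open>Dual Banach algebras\<close>

text \<open>
  A Banach algebra \<open>'b\<close> with predual \<open>'p\<close> is given through the identification \<open>\<Phi>\<close> of \<open>'b\<close> with
  the dual of \<open>'p\<close>. It need not be isometric.
\<close>

definition weak_star_topology ::
  "('b \<Rightarrow> ('p::complex_banach \<Rightarrow>\<^sub>C\<^sub>L complex)) \<Rightarrow> 'b topology"
  where "weak_star_topology \<Phi> = weak_topology UNIV (range (\<lambda>p b. \<Phi> b *\<^sub>V p))"

definition dual_banach_algebra ::
  "('b::complex_banach_algebra \<Rightarrow> ('p::complex_banach \<Rightarrow>\<^sub>C\<^sub>L complex)) \<Rightarrow> bool"
  where "dual_banach_algebra \<Phi> \<longleftrightarrow>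
    bij \<Phi> \<and> bounded_clinear \<Phi> \<and> bounded_clinear (inv \<Phi>) \<and>
    (\<forall>a. continuous_map (weak_star_topology \<Phi>) (weak_star_topology \<Phi>) (\<lambda>b. a * b)) \<and>
    (\<forall>a. continuous_map (weak_star_topology \<Phi>) (weak_star_topology \<Phi>) (\<lambda>b. b * a))"

definition banach_algebra_isomorphism ::
  "('h::complex_hilbert \<Rightarrow>\<^sub>C\<^sub>L 'h) set \<Rightarrow> (('h \<Rightarrow>\<^sub>C\<^sub>L 'h) \<Rightarrow> 'b::complex_banach_algebra) \<Rightarrow> bool"
  where "banach_algebra_isomorphism M \<theta> \<longleftrightarrow>
    (\<forall>x\<in>M. \<forall>y\<in>M. \<theta> (x + y) = \<theta> x + \<theta> y) \<and>
    (\<forall>a. \<forall>x\<in>M. \<theta> (a *\<^sub>C x) = a *\<^sub>C \<theta> x) \<and>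
    (\<forall>x\<in>M. \<forall>y\<in>M. \<theta> (x o\<^sub>C\<^sub>L y) = \<theta> x * \<theta> y) \<and>
    (\<exists>K. \<forall>x\<in>M. norm (\<theta> x) \<le> K * norm x) \<and>
    bij_betw \<theta> M UNIV"

end

theory Submission
  imports Defs
begin

text \<open>
  Fix \<open>p\<close> in the predual of the dual Banach algebra. What has to be shown is that the bounded
  functional \<open>f = (\<lambda>x. \<langle>\<theta> x, p\<rangle>)\<close> on \<open>M\<close> is normal. The dual topology pulled back along
  \<open>\<theta>\<close> is used through two properties only: bounded nets have cluster points, by Tychonoff's theorem
  (\<open>bounded_cluster\<close>), and right multiplication by a fixed element is continuous
  (\<open>right_compose_limit\<close>). Since \<open>\<theta>\<close> ignores adjoints, positivity says nothing about cluster points.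
  Instead, products with well chosen elements of \<open>M\<close> identify them.

  \<^item> For a set \<open>D\<close> of vectors let \<open>p\<^sub>D \<in> M\<close> project onto the vectors killed by every \<open>w \<in> M\<close> that
    kills \<open>D\<close>. A cluster point \<open>z\<close> of the net \<open>w p\<^sub>D\<close>, \<open>D\<close> finite, satisfies
    \<open>z p\<^sub>D = w p\<^sub>D\<close> for every finite \<open>D\<close>, hence \<open>z = w\<close>: the functional sees \<open>w\<close> through finitely many
    vectors. If no finite set \<open>D\<close> gave \<open>\<bar>f w\<bar> \<le> \<epsilon> \<parallel>w\<parallel>\<close> for all \<open>w\<close> killing \<open>D\<close>, one could pick
    \<open>n\<close> elements of norm at most \<open>1\<close> that live on orthogonal subspaces and on which \<open>f\<close> is at least
    \<open>\<epsilon> / 2\<close>. Their sum has norm at most \<open>\<surd>n\<close>, while \<open>f\<close> is at least \<open>n \<epsilon> / 2\<close> there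
    (\<open>finitely_supported_up_to\<close>).

  \<^item> Let \<open>x\<^sub>k \<in> M\<close> be bounded with \<open>x\<^sub>k \<xi> \<rightarrow> 0\<close> fast, and let \<open>z\<close> be a cluster point. The resolvent
    \<open>a = (1 + \<Sum>k. y\<^sub>k\<^sup>* y\<^sub>k)\<^sup>-\<^sup>1\<close> with \<open>y\<^sub>k = \<delta> 2\<^sup>k x\<^sub>k\<close> belongs to \<open>M\<close>, satisfies \<open>\<parallel>y\<^sub>k a\<parallel> \<le> 1\<close>, and
    moves \<open>\<xi>\<close> by at most a multiple of \<open>\<delta>\<close> (\<open>compressor_exists\<close>). Thus \<open>x\<^sub>k a \<rightarrow> 0\<close> in norm, so \<open>z a = 0\<close>,
    and \<open>\<delta> \<rightarrow> 0\<close> gives \<open>z \<xi> = 0\<close> (\<open>strong_null_sequence_cluster\<close>). Together with the previous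
    item, for every \<open>\<epsilon> > 0\<close> there are finitely many vectors \<open>\<xi>\<close> such that
    \<open>\<bar>f x\<bar> \<le> \<epsilon> \<parallel>x\<parallel> + (\<Sum>\<xi>. \<parallel>x \<xi>\<parallel>)\<close> on \<open>M\<close> (\<open>strong_estimate\<close>).

  \<^item> By a Hahn-Banach argument \<open>f\<close> is then a norm limit on \<open>M\<close> of finite sums of functionals
    \<open>x \<mapsto> \<langle>x \<xi>, \<eta>\<rangle>\<close> (\<open>approximation_by_vector_sum\<close>). Hahn-Banach on the space of such sums, combined
    with the bicommutant property, shows that a sum of norm below \<open>s\<close> on \<open>M\<close> can be rewritten with
    \<open>(\<Sum>. \<parallel>\<xi>\<parallel> \<parallel>\<eta>\<parallel>) < s\<close> (\<open>economical_vector_sum\<close>). The telescoping series of a fast approximation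
    is therefore a single square-summable representation (\<open>vn_predualI\<close>).

  One point concerns norms: the cluster points above must be bounded in \<open>M\<close>, so \<open>\<theta>\<close> has to be bounded
  below. This follows from invariance of spectra: \<open>\<parallel>x\<parallel>\<^sup>2\<close> lies in the spectrum of \<open>x\<^sup>* x\<close>, so it is at most
  \<open>\<parallel>\<theta> (x\<^sup>* x)\<parallel>\<close> (\<open>norm_square_le_theta\<close>).
\<close>

section \<open>Linear functionals below a sublinear one\<close>

text \<open>
  Homogeneity is demanded as an inequality for positive factors; applied to a factor and its
  inverse it gives equality.
\<close>

definition sublinear :: "('v::real_vector \<Rightarrow> real) \<Rightarrow> bool"
  where "sublinear p \<longleftrightarrow>
    (\<forall>x y. p (x + y) \<le> p x + p y) \<and> (\<forall>t>0. \<forall>x. p (t *\<^sub>R x) \<le> t * p x) \<and> p 0 = 0"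

lemma sublinearD:
  assumes "sublinear p"
  shows "p (x + y) \<le> p x + p y" "t > 0 \<Longrightarrow> p (t *\<^sub>R x) \<le> t * p x" "p 0 = 0" "- p (- x) \<le> p x"
proof -
  show *: "p (x + y) \<le> p x + p y" "t > 0 \<Longrightarrow> p (t *\<^sub>R x) \<le> t * p x" "p 0 = 0" for x y
    using assms by (auto simp: sublinear_def)
  show "- p (- x) \<le> p x"
    using *(1)[of x "- x"] *(3) by simp
qed

text \<open>
  The infimum of \<open>p (x + T a) - r a\<close> over \<open>a \<in> A\<close> is sublinear. Any linear functional below it is
  below \<open>p\<close> (take \<open>a = 0\<close>) and, evaluated at \<open>- T a\<close>, lies above \<open>r\<close> along \<open>T\<close>.
\<close>

lemma sublinear_sandwich_step:
  fixes p :: "'v::real_vector \<Rightarrow> real" and T :: "'a::real_vector \<Rightarrow> 'v"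
  assumes p: "sublinear p"
    and A: "0 \<in> A" "\<And>a b. a \<in> A \<Longrightarrow> b \<in> A \<Longrightarrow> a + b \<in> A"
      "\<And>t a. t > 0 \<Longrightarrow> a \<in> A \<Longrightarrow> t *\<^sub>R a \<in> A"
    and T: "\<And>a b. a \<in> A \<Longrightarrow> b \<in> A \<Longrightarrow> T (a + b) = T a + T b"
      "\<And>t a. t > 0 \<Longrightarrow> a \<in> A \<Longrightarrow> T (t *\<^sub>R a) = t *\<^sub>R T a"
    and r: "\<And>a b. a \<in> A \<Longrightarrow> b \<in> A \<Longrightarrow> r (a + b) \<ge> r a + r b"
      "\<And>t a. t > 0 \<Longrightarrow> a \<in> A \<Longrightarrow> r (t *\<^sub>R a) \<ge> t * r a"
    and le: "\<And>a. a \<in> A \<Longrightarrow> r a \<le> p (T a)"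
    and zero: "T 0 = 0" "r 0 = 0"
  obtains q where "sublinear q" "\<And>x. q x \<le> p x" "\<And>a. a \<in> A \<Longrightarrow> q (- T a) \<le> - r a"
proof -
  define q where "q = (\<lambda>x. INF a\<in>A. p (x + T a) - r a)"
  have lower: "- p (- x) \<le> p (x + T a) - r a" if "a \<in> A" for x a
    using sublinearD(1)[OF p, of "x + T a" "- x"] le[OF that] by simp
  have bdd: "bdd_below ((\<lambda>a. p (x + T a) - r a) ` A)" for x
    using lower by (rule bdd_belowI2)
  have upper: "q x \<le> p (x + T a) - r a" if "a \<in> A" for x a
    unfolding q_def by (rule cINF_lower[OF bdd that])
  have greatest: "c \<le> q x" if "\<And>a. a \<in> A \<Longrightarrow> c \<le> p (x + T a) - r a" for c x
    unfolding q_def using A(1) that by (intro cINF_greatest) auto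
  have "q (x + y) \<le> q x + q y" for x y
  proof -
    have 1: "q (x + y) \<le> (p (x + T a) - r a) + (p (y + T b) - r b)" if "a \<in> A" "b \<in> A" for a b
      using upper[of "a + b" "x + y"] A(2)[OF that] T(1)[OF that] r(1)[OF that]
        sublinearD(1)[OF p, of "x + T a" "y + T b"] by (simp add: algebra_simps)
    have "q (x + y) - (p (x + T a) - r a) \<le> q y" if "a \<in> A" for a
      by (rule greatest) (use 1[OF that] in \<open>simp add: algebra_simps\<close>)
    then have "q (x + y) - q y \<le> q x"
      by (intro greatest) (simp add: algebra_simps)
    then show ?thesis by simp
  qed
  moreover have "q (t *\<^sub>R x) \<le> t * q x" if "t > 0" for t x
  proof -
    have "q (t *\<^sub>R x) / t \<le> q x"
    proof (rule greatest)
      fix a assume a: "a \<in> A"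
      have "q (t *\<^sub>R x) \<le> p (t *\<^sub>R (x + T a)) - t * r a"
        using upper[OF A(3)[OF that a], of "t *\<^sub>R x"] T(2)[OF that a] r(2)[OF that a]
        by (simp add: algebra_simps)
      also have "\<dots> \<le> t * p (x + T a) - t * r a"
        using sublinearD(2)[OF p that] by simp
      finally show "q (t *\<^sub>R x) / t \<le> p (x + T a) - r a"
        using that by (simp add: field_simps)
    qed
    then show ?thesis using that by (simp add: field_simps)
  qed
  moreover have "q 0 = 0"
    using upper[OF A(1), of 0] greatest[of 0 0] lower[of _ 0] zero sublinearD(3)[OF p]
    by (auto intro!: antisym)
  ultimately have "sublinear q" by (simp add: sublinear_def)
  moreover have "q x \<le> p x" for x
    using upper[OF A(1), of x] zero by simp
  moreover have "q (- T a) \<le> - r a" if "a \<in> A" for a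
    using upper[OF that, of "- T a"] sublinearD(3)[OF p] by simp
  ultimately show ?thesis by (rule that)
qed

text \<open>
  A minimal sublinear functional below \<open>p\<close>, which Zorn's lemma provides, is linear.
\<close>

lemma linear_below_sublinear:
  fixes p :: "'v::real_vector \<Rightarrow> real"
  assumes p: "sublinear p"
  obtains L where "linear L" "\<And>x. L x \<le> p x"
proof -
  define A where "A = {q. sublinear q \<and> (\<forall>x. q x \<le> p x)}"
  let ?P = "\<lambda>q q' :: 'v \<Rightarrow> real. \<forall>x. q' x \<le> q x"
  have "\<exists>m\<in>A. \<forall>a\<in>A. ?P m a \<longrightarrow> a = m"
  proof (rule predicate_Zorn)
    show "partial_order_on A (relation_of ?P A)"
      by (rule partial_order_on_relation_ofI) (auto intro!: ext intro: order_trans order.antisym)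
  next
    fix C assume C: "C \<in> Chains (relation_of ?P A)"
    then have CA: "C \<subseteq> A" by (auto simp: Chains_def relation_of_def)
    have chain: "?P a b \<or> ?P b a" if "a \<in> C" "b \<in> C" for a b
      using C that by (auto simp: Chains_def relation_of_def)
    show "\<exists>u\<in>A. \<forall>a\<in>C. ?P a u"
    proof (cases "C = {}")
      case True
      then show ?thesis using p by (auto simp: A_def)
    next
      case False
      define u where "u = (\<lambda>x. INF q\<in>C. q x)"
      have bdd: "bdd_below ((\<lambda>q. q x) ` C)" for x
      proof (rule bdd_belowI2)
        fix q assume "q \<in> C"
        then have "sublinear q" "q (- x) \<le> p (- x)" using CA by (auto simp: A_def)
        then show "- p (- x) \<le> q x" using sublinearD(4)[of q x] by linarith
      qed
      have upper: "u x \<le> q x" if "q \<in> C" for q x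
        unfolding u_def by (rule cINF_lower[OF bdd that])
      have greatest: "c \<le> u x" if "\<And>q. q \<in> C \<Longrightarrow> c \<le> q x" for c x
        unfolding u_def using False that by (rule cINF_greatest)
      have sub: "sublinear q" if "q \<in> C" for q using that CA by (auto simp: A_def)
      have "u (x + y) \<le> u x + u y" for x y
      proof -
        have 1: "u (x + y) \<le> q x + q' y" if "q \<in> C" "q' \<in> C" for q q'
          using chain[OF that]
        proof
          assume "?P q q'"
          then show ?thesis
            using upper[OF that(2), of "x + y"] sublinearD(1)[OF sub[OF that(2)], of x y]
            by (smt (verit))
        next
          assume "?P q' q"
          then show ?thesis
            using upper[OF that(1), of "x + y"] sublinearD(1)[OF sub[OF that(1)], of x y]
            by (smt (verit))
        qed
        have "u (x + y) - q x \<le> u y" if "q \<in> C" for q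
          by (rule greatest) (use 1[OF that] in \<open>simp add: algebra_simps\<close>)
        then have "u (x + y) - u y \<le> u x"
          by (intro greatest) (simp add: algebra_simps)
        then show ?thesis by simp
      qed
      moreover have "u (t *\<^sub>R x) \<le> t * u x" if "t > 0" for t x
      proof -
        have "u (t *\<^sub>R x) / t \<le> u x"
        proof (rule greatest)
          fix q assume q: "q \<in> C"
          show "u (t *\<^sub>R x) / t \<le> q x"
            using upper[OF q, of "t *\<^sub>R x"] sublinearD(2)[OF sub[OF q] that, of x] that
            by (simp add: field_simps)
        qed
        then show ?thesis using that by (simp add: field_simps)
      qed
      moreover have "u 0 = 0"
        using greatest[of 0 0] upper[of _ 0] False sublinearD(3)[OF sub]
        by (metis (no_types, lifting) all_not_in_conv order.antisym order.refl)
      ultimately have "sublinear u" by (simp add: sublinear_def)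
      moreover have "u x \<le> p x" for x
      proof -
        obtain q where q: "q \<in> C" using False by blast
        then have "q x \<le> p x" using CA by (auto simp: A_def)
        then show ?thesis using upper[OF q, of x] by linarith
      qed
      ultimately show ?thesis using upper by (auto simp: A_def)
    qed
  qed
  then obtain m where m: "sublinear m" "\<And>x. m x \<le> p x"
    and min: "\<And>a. sublinear a \<Longrightarrow> (\<And>x. a x \<le> p x) \<Longrightarrow> (\<And>x. a x \<le> m x) \<Longrightarrow> a = m"
    by (auto simp: A_def)
  \<comment> \<open>Lowering \<open>m\<close> along the ray through \<open>v\<close> cannot change it, so \<open>m\<close> is odd.\<close>
  have neg: "m (- v) \<le> - m v" for v
  proof -
    obtain q where q: "sublinear q" "\<And>x. q x \<le> m x" "\<And>t. t \<in> {0..} \<Longrightarrow> q (- (t *\<^sub>R v)) \<le> - (t * m v)"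
    proof (rule sublinear_sandwich_step[OF m(1), of "{0::real..}" "\<lambda>t. t *\<^sub>R v" "\<lambda>t. t * m v"])
      fix a :: real assume "a \<in> {0..}"
      moreover have "m v = m (inverse a *\<^sub>R (a *\<^sub>R v))" if "a > 0" using that by simp
      moreover have "m (inverse a *\<^sub>R (a *\<^sub>R v)) \<le> inverse a * m (a *\<^sub>R v)" if "a > 0"
        by (rule sublinearD(2)[OF m(1)]) (use that in simp)
      ultimately show "a * m v \<le> m (a *\<^sub>R v)"
        using sublinearD(3)[OF m(1)] by (cases "a = 0") (auto simp: field_simps)
    qed (auto simp: algebra_simps)
    have "q = m" using q m(2) by (intro min) (auto intro: order_trans)
    then show ?thesis using q(3)[of 1] by simp
  qed
  have odd: "m (- v) = - m v" for v
    using neg[of v] sublinearD(4)[OF m(1), of "v"] by linarith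
  have add: "m (x + y) = m x + m y" for x y
    using sublinearD(1)[OF m(1), of x y] sublinearD(1)[OF m(1), of "- x" "- y"]
      odd[of x] odd[of y] odd[of "x + y"] by simp
  have pos: "m (t *\<^sub>R x) = t * m x" if "t > 0" for t x
    using sublinearD(2)[OF m(1) that, of x] sublinearD(2)[OF m(1) that, of "- x"] odd[of x]
      odd[of "t *\<^sub>R x"] by simp
  have scale: "m (t *\<^sub>R x) = t * m x" for t x
    using pos[of t x] pos[of "- t" x] odd[of "t *\<^sub>R x"] sublinearD(3)[OF m(1)]
    by (cases t "0::real" rule: linorder_cases) auto
  have "linear m" by (rule linearI) (simp_all add: add scale)
  then show ?thesis using m(2) by (rule that)
qed

text \<open>
  The Mazur-Orlicz form of the Hahn-Banach theorem. The set \<open>A\<close> is a convex cone, \<open>T\<close> is additive and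
  \<open>r\<close> superadditive on it. This form is convenient because the functional to be dominated need not live
  on a subspace of the space that carries \<open>p\<close>.
\<close>

theorem mazur_orlicz:
  fixes p :: "'v::real_vector \<Rightarrow> real" and T :: "'a::real_vector \<Rightarrow> 'v"
  assumes "sublinear p"
    and "0 \<in> A" "\<And>a b. a \<in> A \<Longrightarrow> b \<in> A \<Longrightarrow> a + b \<in> A"
      "\<And>t a. t > 0 \<Longrightarrow> a \<in> A \<Longrightarrow> t *\<^sub>R a \<in> A"
    and "\<And>a b. a \<in> A \<Longrightarrow> b \<in> A \<Longrightarrow> T (a + b) = T a + T b"
      "\<And>t a. t > 0 \<Longrightarrow> a \<in> A \<Longrightarrow> T (t *\<^sub>R a) = t *\<^sub>R T a"
    and "\<And>a b. a \<in> A \<Longrightarrow> b \<in> A \<Longrightarrow> r (a + b) \<ge> r a + r b"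
      "\<And>t a. t > 0 \<Longrightarrow> a \<in> A \<Longrightarrow> r (t *\<^sub>R a) \<ge> t * r a"
    and "\<And>a. a \<in> A \<Longrightarrow> r a \<le> p (T a)"
    and "T 0 = 0" "r 0 = 0"
  obtains L where "linear L" "\<And>x. L x \<le> p x" "\<And>a. a \<in> A \<Longrightarrow> r a \<le> L (T a)"
proof -
  obtain q where q: "sublinear q" "\<And>x. q x \<le> p x" "\<And>a. a \<in> A \<Longrightarrow> q (- T a) \<le> - r a"
    using sublinear_sandwich_step[of p A T r] assms by blast
  obtain L where L: "linear L" "\<And>x. L x \<le> q x"
    using linear_below_sublinear[OF q(1)] by blast
  show ?thesis
  proof
    show "linear L" by fact
    show "L x \<le> p x" for x using L(2) q(2) order_trans by blast
    show "r a \<le> L (T a)" if "a \<in> A" for a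
      using L(2)[of "- T a"] q(3)[OF that] linear_neg[OF L(1), of "T a"] by linarith
  qed
qed

section \<open>Complex inner products\<close>

lemma scaleC_one [simp]: "1 *\<^sub>C (x::'a::complex_normed_vector) = x"
  using scaleR_scaleC[of 1 x] by simp

lemma scaleC_zero_left [simp]: "0 *\<^sub>C (x::'a::complex_normed_vector) = 0"
  using scaleR_scaleC[of 0 x] by simp

lemma scaleC_minus_one: "(- 1) *\<^sub>C (x::'a::complex_normed_vector) = - x"
  using scaleR_scaleC[of "- 1" x] by simp

lemma cinner_add_right: "cinner x (y + z) = cinner x y + cinner x z"
  by (metis cinner_add_left cinner_commute complex_cnj_add)

lemma cinner_scaleC_right: "cinner x (a *\<^sub>C y) = cnj a * cinner x y"
  by (metis cinner_scaleC_left cinner_commute complex_cnj_mult)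

lemma cinner_zero_left [simp]: "cinner 0 x = 0"
  by (metis cinner_scaleC_left mult_zero_left scaleC_zero_left)

lemma cinner_zero_right [simp]: "cinner x 0 = 0"
  by (metis cinner_zero_left cinner_commute complex_cnj_zero)

lemma cinner_minus_left: "cinner (- x) y = - cinner x y"
  by (metis cinner_scaleC_left scaleC_minus_one mult_minus1)

lemma cinner_minus_right: "cinner x (- y) = - cinner x y"
  by (metis cinner_minus_left cinner_commute complex_cnj_minus)

lemma cinner_diff_left: "cinner (x - y) z = cinner x z - cinner y z"
  using cinner_add_left[of x "- y" z] by (simp add: cinner_minus_left)

lemma cinner_diff_right: "cinner x (y - z) = cinner x y - cinner x z"
  using cinner_add_right[of x y "- z"] by (simp add: cinner_minus_right)

lemma cinner_scaleR_left: "cinner (r *\<^sub>R x) y = of_real r * cinner x y"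
  by (simp add: scaleR_scaleC cinner_scaleC_left)

lemma cinner_scaleR_right: "cinner x (r *\<^sub>R y) = of_real r * cinner x y"
  by (simp add: scaleR_scaleC cinner_scaleC_right)

lemmas cinner_simps = cinner_add_left cinner_add_right cinner_diff_left cinner_diff_right
  cinner_scaleC_left cinner_scaleC_right cinner_scaleR_left cinner_scaleR_right
  cinner_minus_left cinner_minus_right

lemma Re_cinner_commute: "Re (cinner x y) = Re (cinner y x)"
  by (metis cinner_commute complex_cnj(1) complex.sel(1) complex_eq_iff cnj.sel(1))

lemma Re_cinner_self: "Re (cinner x x) = (norm x)\<^sup>2"
  by (simp add: cinner_self del: of_real_power)

lemma norm_add_square: "(norm (x + y))\<^sup>2 = (norm x)\<^sup>2 + 2 * Re (cinner x y) + (norm y)\<^sup>2"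
  for x y :: "'h::complex_hilbert"
  unfolding Re_cinner_self[symmetric] by (simp add: cinner_simps Re_cinner_commute[of y x])

lemma cinner_cauchy_schwarz: "cmod (cinner x y) \<le> norm x * norm y"
proof (cases "y = 0")
  case False
  define c where "c = cinner x y / of_real ((norm y)\<^sup>2)"
  have c: "cinner x y = c * of_real ((norm y)\<^sup>2)" using False by (simp add: c_def)
  have "0 \<le> Re (cinner (x - c *\<^sub>C y) (x - c *\<^sub>C y))"
    unfolding Re_cinner_self by simp
  also have "cinner (x - c *\<^sub>C y) (x - c *\<^sub>C y)
      = of_real ((norm x)\<^sup>2) - cnj c * cinner x y - c * cnj (cinner x y) + c * cnj c * of_real ((norm y)\<^sup>2)"
    unfolding cinner_simps
    by (simp add: cinner_self cinner_commute[of y x] algebra_simps del: of_real_power)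
  also have "\<dots> = of_real ((norm x)\<^sup>2) - (c * cnj c) * of_real ((norm y)\<^sup>2)"
    unfolding c by (simp add: algebra_simps del: of_real_power)
  also have "\<dots> = of_real ((norm x)\<^sup>2 - (cmod c)\<^sup>2 * (norm y)\<^sup>2)"
    by (simp add: complex_norm_square[symmetric])
  finally have "(cmod c * norm y)\<^sup>2 \<le> (norm x)\<^sup>2" by (simp add: power_mult_distrib)
  then have "cmod c * norm y \<le> norm x" by (rule power2_le_imp_le) simp
  then have "cmod c * norm y * norm y \<le> norm x * norm y"
    by (rule mult_right_mono) simp
  then show ?thesis unfolding c by (simp add: norm_mult power2_eq_square mult.assoc)
qed simp

lemma Re_cinner_le: "Re (cinner x y) \<le> norm x * norm y"
  using complex_Re_le_cmod cinner_cauchy_schwarz order_trans by blast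

lemma bounded_linear_cinner_left: "bounded_linear (\<lambda>x. cinner x y)"
  by (rule bounded_linear_intro[where K = "norm y"])
    (auto simp: cinner_simps scaleR_conv_of_real cinner_cauchy_schwarz)

lemma Re_cinner_ext: "(\<And>v. Re (cinner v x) = Re (cinner v y)) \<Longrightarrow> x = y"
proof -
  assume "\<And>v. Re (cinner v x) = Re (cinner v y)"
  from this[of "x - y"] have "Re (cinner (x - y) (x - y)) = 0" by (simp add: cinner_simps)
  then show "x = y" by (simp add: Re_cinner_self)
qed

text \<open>To be applied to the energy along a line through a minimiser.\<close>

lemma quadratic_nonneg_imp_linear_zero:
  assumes "\<And>t::real. 0 \<le> t\<^sup>2 * a + 2 * t * b"
  shows "b = 0"
proof (rule ccontr)
  assume "b \<noteq> 0"
  define d where "d = \<bar>a\<bar> + 1"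
  have d: "d > 0" "a - 2 * d < 0" by (auto simp: d_def)
  have "(- b / d)\<^sup>2 * a + 2 * (- b / d) * b = b\<^sup>2 / d\<^sup>2 * (a - 2 * d)"
    using d(1) by (simp add: power2_eq_square field_simps)
  moreover have "\<dots> < 0"
    using \<open>b \<noteq> 0\<close> d by (intro mult_pos_neg) auto
  ultimately show False using assms[of "- b / d"] by simp
qed

section \<open>Riesz representation for closed positive forms\<close>

text \<open>
  A positive sesquilinear form \<open>B\<close> on a subspace \<open>C\<close>, not necessarily closed or dense. The last
  assumption is the weak form of closedness that minimisation needs: lower semicontinuity along
  sequences on which the energy converges.
\<close>

locale closed_positive_form =
  fixes C :: "'h::complex_hilbert set" and B :: "'h \<Rightarrow> 'h \<Rightarrow> complex"
  assumes zero_C: "0 \<in> C"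
    and add_C: "u \<in> C \<Longrightarrow> v \<in> C \<Longrightarrow> u + v \<in> C"
    and scale_C: "u \<in> C \<Longrightarrow> a *\<^sub>C u \<in> C"
    and B_add_left: "u \<in> C \<Longrightarrow> v \<in> C \<Longrightarrow> w \<in> C \<Longrightarrow> B (u + v) w = B u w + B v w"
    and B_scale_left: "u \<in> C \<Longrightarrow> v \<in> C \<Longrightarrow> B (a *\<^sub>C u) v = a * B u v"
    and B_commute: "u \<in> C \<Longrightarrow> v \<in> C \<Longrightarrow> B u v = cnj (B v u)"
    and B_nonneg: "u \<in> C \<Longrightarrow> 0 \<le> Re (B u u)"
    and closed_form: "(\<And>n. s n \<in> C) \<Longrightarrow> s \<longlonglongrightarrow> u \<Longrightarrow> (\<lambda>n. Re (B (s n) (s n))) \<longlonglongrightarrow> m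
      \<Longrightarrow> u \<in> C \<and> Re (B u u) \<le> m"
begin

lemma scaleR_C: "u \<in> C \<Longrightarrow> r *\<^sub>R u \<in> C"
  by (simp add: scaleR_scaleC scale_C)

lemma diff_C: "u \<in> C \<Longrightarrow> v \<in> C \<Longrightarrow> u - v \<in> C"
  using add_C[of u "- v"] scaleR_C[of v "- 1"] by simp

text \<open>
  The form of \<open>1 + B\<close>, when \<open>B\<close> is thought of as a positive self-adjoint operator.
\<close>

definition shifted where "shifted u v = cinner u v + B u v"

lemma Re_shifted_commute: "u \<in> C \<Longrightarrow> v \<in> C \<Longrightarrow> Re (shifted u v) = Re (shifted v u)"
  using B_commute[of u v] Re_cinner_commute[of u v] by (simp add: shifted_def)

lemma shifted_add_left: "u \<in> C \<Longrightarrow> v \<in> C \<Longrightarrow> w \<in> C \<Longrightarrow> shifted (u + v) w = shifted u w + shifted v w"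
  by (simp add: shifted_def B_add_left cinner_add_left)

lemma shifted_scaleC_left: "u \<in> C \<Longrightarrow> v \<in> C \<Longrightarrow> shifted (a *\<^sub>C u) v = a * shifted u v"
  by (simp add: shifted_def B_scale_left cinner_scaleC_left algebra_simps)

lemma Re_shifted_scaleR_left: "u \<in> C \<Longrightarrow> v \<in> C \<Longrightarrow> Re (shifted (r *\<^sub>R u) v) = r * Re (shifted u v)"
  unfolding scaleR_scaleC shifted_scaleC_left by simp

lemma Re_shifted_expand:
  assumes "u \<in> C" "v \<in> C"
  shows "Re (shifted (u + r *\<^sub>R v) (u + r *\<^sub>R v)) = Re (shifted u u) + 2 * r * Re (shifted v u) + r\<^sup>2 * Re (shifted v v)"
proof -
  note C = assms scaleR_C[OF assms(2), of r] add_C[OF assms(1) scaleR_C[OF assms(2), of r]]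
  have *: "Re (shifted (u + r *\<^sub>R v) w) = Re (shifted u w) + r * Re (shifted v w)" if "w \<in> C" for w
    using shifted_add_left[OF C(1,3) that] Re_shifted_scaleR_left[OF C(2) that, of r] by simp
  have "Re (shifted w (u + r *\<^sub>R v)) = Re (shifted w u) + r * Re (shifted w v)" if "w \<in> C" for w
    using *[OF that] Re_shifted_commute[OF that] C by metis
  then show ?thesis
    using *[OF C(4)] C(1,2) Re_shifted_commute[OF C(1,2)] by (simp add: algebra_simps power2_eq_square)
qed

lemma norm_le_Re_shifted: "u \<in> C \<Longrightarrow> (norm u)\<^sup>2 \<le> Re (shifted u u)"
  using B_nonneg[of u] by (simp add: shifted_def Re_cinner_self)

text \<open>
  The energy \<open>B u u + \<parallel>u\<parallel>\<^sup>2 - 2 g u\<close> has a minimiser \<open>u\<close> on \<open>C\<close>, and the vanishing of its derivative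
  in the direction \<open>v\<close> is the claimed equation. With the zero form this yields the Riesz representation
  theorem and orthogonal projections, with general forms the resolvents used later.
\<close>

theorem riesz_closed_form:
  assumes g: "bounded_linear g"
  obtains u where "u \<in> C" "\<And>v. v \<in> C \<Longrightarrow> Re (shifted v u) = g v"
proof -
  interpret g: bounded_linear g by fact
  obtain K where K: "\<And>v. norm (g v) \<le> norm v * K" using g.bounded by blast
  define F where "F u = Re (shifted u u) - 2 * g u" for u
  have lower: "- K\<^sup>2 \<le> F u" if "u \<in> C" for u
  proof -
    have "0 \<le> (norm u - K)\<^sup>2" by simp
    also have "\<dots> \<le> F u + K\<^sup>2"
      using norm_le_Re_shifted[OF that] K[of u] by (simp add: F_def power2_diff)
    finally show ?thesis by simp
  qed
  define m where "m = (INF u\<in>C. F u)"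
  have bdd: "bdd_below (F ` C)" using lower by (rule bdd_belowI2)
  have m_le: "m \<le> F u" if "u \<in> C" for u
    unfolding m_def by (rule cINF_lower[OF bdd that])
  have "\<exists>u\<in>C. F u < m + inverse (Suc n)" for n
    using cINF_less_iff[OF _ bdd, of "m + inverse (Suc n)"] zero_C by (auto simp: m_def)
  \<comment> \<open>A minimising sequence.\<close>
  then obtain s where sC: "\<And>n. s n \<in> C" and s: "\<And>n. F (s n) < m + inverse (Suc n)"
    by metis
  \<comment> \<open>The parallelogram law turns near-minimality of two vectors into their closeness.\<close>
  have mid: "(norm (u - v))\<^sup>2 \<le> 2 * F u + 2 * F v - 4 * m" if "u \<in> C" "v \<in> C" for u v
  proof -
    define w where "w = (1/2) *\<^sub>R (u + v)"
    have wC: "w \<in> C" using that by (simp add: w_def add_C scaleR_C)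
    have "Re (shifted (0 + (1/2) *\<^sub>R (u + v)) (0 + (1/2) *\<^sub>R (u + v))) = Re (shifted (u + v) (u + v)) / 4"
      using Re_shifted_expand[OF zero_C add_C[OF that], of "1/2"]
        Re_shifted_scaleR_left[OF zero_C zero_C, of 0]
        Re_shifted_commute[OF zero_C add_C[OF that]] Re_shifted_scaleR_left[OF zero_C add_C[OF that], of 0]
      by (simp add: power2_eq_square)
    then have "4 * F w = Re (shifted (u + 1 *\<^sub>R v) (u + 1 *\<^sub>R v)) - 4 * (g u + g v)"
      by (simp add: F_def w_def g.scaleR g.add field_simps)
    then have "2 * F u + 2 * F v - 4 * F w = Re (shifted (u + (- 1) *\<^sub>R v) (u + (- 1) *\<^sub>R v))"
      unfolding Re_shifted_expand[OF that] by (simp add: F_def)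
    moreover have "\<dots> \<ge> (norm (u - v))\<^sup>2"
      using norm_le_Re_shifted[OF diff_C[OF that]] by simp
    ultimately show ?thesis using m_le[OF wC] by simp
  qed
  have "Cauchy s"
  proof (rule metric_CauchyI)
    fix e :: real assume e: "e > 0"
    obtain N where N: "inverse (real (Suc N)) < e\<^sup>2 / 4"
      using reals_Archimedean[of "e\<^sup>2 / 4"] e by auto
    have "dist (s n) (s k) < e" if "n \<ge> N" "k \<ge> N" for n k
    proof -
      have "inverse (real (Suc n)) \<le> inverse (real (Suc N))" "inverse (real (Suc k)) \<le> inverse (real (Suc N))"
        using that by (auto simp: field_simps)
      then have "(norm (s n - s k))\<^sup>2 < e\<^sup>2"
        using mid[OF sC sC, of n k] s[of n] s[of k] N by linarith
      then show ?thesis using e by (simp add: dist_norm power2_less_imp_less)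
    qed
    then show "\<exists>N. \<forall>n\<ge>N. \<forall>k\<ge>N. dist (s n) (s k) < e" by blast
  qed
  then obtain u where u: "s \<longlonglongrightarrow> u" using Cauchy_convergent convergent_def by blast
  have "(\<lambda>n. F (s n)) \<longlonglongrightarrow> m"
  proof (rule tendsto_sandwich[OF _ _ tendsto_const])
    show "(\<lambda>n. m + inverse (Suc n)) \<longlonglongrightarrow> m"
      using tendsto_add[OF tendsto_const LIMSEQ_inverse_real_of_nat, of m] by simp
  qed (use m_le[OF sC] s in \<open>auto intro!: always_eventually less_imp_le\<close>)
  then have "(\<lambda>n. F (s n) - (norm (s n))\<^sup>2 + 2 * g (s n)) \<longlonglongrightarrow> m - (norm u)\<^sup>2 + 2 * g u"
    by (intro tendsto_intros g.tendsto u)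
  moreover have "(\<lambda>n. F (s n) - (norm (s n))\<^sup>2 + 2 * g (s n)) = (\<lambda>n. Re (B (s n) (s n)))"
    by (simp add: F_def shifted_def Re_cinner_self)
  ultimately have "u \<in> C \<and> Re (B u u) \<le> m - (norm u)\<^sup>2 + 2 * g u"
    using closed_form[OF sC u] by simp
  then have uC: "u \<in> C" and "F u \<le> m" by (auto simp: F_def shifted_def Re_cinner_self)
  then have min: "F u \<le> F v" if "v \<in> C" for v using m_le[OF that] by simp
  show ?thesis
  proof
    fix v assume v: "v \<in> C"
    have "Re (shifted v u) - g v = 0"
    proof (rule quadratic_nonneg_imp_linear_zero)
      fix t :: real
      have "F (u + t *\<^sub>R v) = F u + (t\<^sup>2 * Re (shifted v v) + 2 * t * (Re (shifted v u) - g v))"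
        unfolding F_def Re_shifted_expand[OF uC v] by (simp add: g.add g.scaleR algebra_simps)
      then show "0 \<le> t\<^sup>2 * Re (shifted v v) + 2 * t * (Re (shifted v u) - g v)"
        using min[OF add_C[OF uC scaleR_C[OF v]], of t] by simp
    qed
    then show "Re (shifted v u) = g v" by simp
  qed (fact uC)
qed

lemma riesz_closed_form_unique:
  assumes "u \<in> C" "u' \<in> C" "\<And>v. v \<in> C \<Longrightarrow> shifted v u = shifted v u'"
  shows "u = u'"
proof -
  have d: "u - u' \<in> C" using assms by (simp add: diff_C)
  have *: "Re (shifted (u + (-1) *\<^sub>R u') w) = Re (shifted u w) - Re (shifted u' w)" if "w \<in> C" for w
    using shifted_add_left[OF assms(1) scaleR_C[OF assms(2)] that, of "- 1"]
      Re_shifted_scaleR_left[OF assms(2) that, of "- 1"] by simp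
  have "Re (shifted (u - u') (u - u')) = 0"
    using *[OF d] Re_shifted_commute[OF assms(1) d] Re_shifted_commute[OF assms(2) d] assms(3)[OF d]
    by simp
  then show ?thesis using norm_le_Re_shifted[OF d] by simp
qed

end

section \<open>Bounded operators and adjoints\<close>

lemma cblinfun_add_right: "T *\<^sub>V (x + y) = T *\<^sub>V x + T *\<^sub>V y"
  and cblinfun_scaleC_right: "T *\<^sub>V (a *\<^sub>C x) = a *\<^sub>C (T *\<^sub>V x)"
  and cblinfun_scaleR_right: "T *\<^sub>V (r *\<^sub>R x) = r *\<^sub>R (T *\<^sub>V x)"
  and cblinfun_diff_right: "T *\<^sub>V (x - y) = T *\<^sub>V x - T *\<^sub>V y"
  and cblinfun_minus_right: "T *\<^sub>V (- x) = - (T *\<^sub>V x)"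
  and cblinfun_zero_right: "T *\<^sub>V 0 = 0"
  and cblinfun_add_left: "(S + T) *\<^sub>V x = S *\<^sub>V x + T *\<^sub>V x"
  and cblinfun_scaleC_left: "(a *\<^sub>C T) *\<^sub>V x = a *\<^sub>C (T *\<^sub>V x)"
  and cblinfun_scaleR_left: "(r *\<^sub>R T) *\<^sub>V x = r *\<^sub>R (T *\<^sub>V x)"
  and cblinfun_diff_left: "(S - T) *\<^sub>V x = S *\<^sub>V x - T *\<^sub>V x"
  and cblinfun_minus_left: "(- T) *\<^sub>V x = - (T *\<^sub>V x)"
  and cblinfun_zero_left: "0 *\<^sub>V x = 0"
  by (transfer; simp add: blinfun.bilinear_simps blinfun_scaleC.rep_eq)+

lemmas cblinfun_simps = cblinfun_add_right cblinfun_scaleC_right cblinfun_scaleR_right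
  cblinfun_diff_right cblinfun_minus_right cblinfun_zero_right cblinfun_add_left
  cblinfun_scaleC_left cblinfun_scaleR_left cblinfun_diff_left cblinfun_minus_left
  cblinfun_zero_left

lemma cblinfun_compose_apply [simp]: "(S o\<^sub>C\<^sub>L T) *\<^sub>V x = S *\<^sub>V (T *\<^sub>V x)"
  by transfer simp

lemma norm_cblinfun: "norm (T *\<^sub>V x) \<le> norm T * norm x"
  by transfer (rule norm_blinfun)

lemma norm_cblinfun_bound: "0 \<le> K \<Longrightarrow> (\<And>x. norm (T *\<^sub>V x) \<le> K * norm x) \<Longrightarrow> norm T \<le> K"
  by transfer (rule norm_blinfun_bound)

lemma bounded_linear_cblinfun: "bounded_linear (\<lambda>x. T *\<^sub>V x)"
  using bounded_clinear_cblinfun_apply[of T] by (simp add: bounded_clinear_def)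

lemma cblinfun_of_map:
  fixes f :: "'a::complex_normed_vector \<Rightarrow> 'b::complex_normed_vector"
  assumes "\<And>x y. f (x + y) = f x + f y" "\<And>a x. f (a *\<^sub>C x) = a *\<^sub>C f x"
    and "\<And>x. norm (f x) \<le> K * norm x"
  obtains T where "\<And>x. T *\<^sub>V x = f x"
proof
  have "bounded_linear f"
    by (rule bounded_linear_intro[where K = K])
      (auto simp: assms(1,2) scaleR_scaleC assms(3) mult.commute[of _ K])
  then have *: "blinfun_apply (Blinfun f) = f" by (rule bounded_linear_Blinfun_apply)
  show "Abs_cblinfun (Blinfun f) *\<^sub>V x = f x" for x
    by (subst cblinfun_apply.rep_eq, subst Abs_cblinfun_inverse) (auto simp: * assms(2))
qed

lemma riesz:
  fixes g :: "'h::complex_hilbert \<Rightarrow> real"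
  assumes "bounded_linear g"
  obtains u where "\<And>v. g v = Re (cinner v u)"
proof -
  interpret closed_positive_form UNIV "\<lambda>_ _ :: 'h. 0"
  proof
    show "u \<in> UNIV \<and> Re 0 \<le> m" if "(\<lambda>n. Re 0) \<longlonglongrightarrow> m" for m and u :: 'h
      using LIMSEQ_unique[OF tendsto_const that] by simp
  qed auto
  obtain u where u: "\<And>v. v \<in> UNIV \<Longrightarrow> Re (shifted v u) = g v"
    using riesz_closed_form[OF assms] by blast
  show ?thesis
    by (rule that[of u]) (use u in \<open>simp add: shifted_def\<close>)
qed

text \<open>
  Only the real part \<open>Y\<close> of a bounded sesquilinear form is given. The condition
  \<open>Y (a x) y = Y x (cnj a y)\<close> replaces complex sesquilinearity, so that real-linear functionals can be
  turned into operators without complexifying them first.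
\<close>

lemma operator_of_form:
  fixes Y :: "'h::complex_hilbert \<Rightarrow> 'h \<Rightarrow> real"
  assumes add_left: "\<And>x x' y. Y (x + x') y = Y x y + Y x' y"
    and add_right: "\<And>x y y'. Y x (y + y') = Y x y + Y x y'"
    and scaleR_right: "\<And>r x y. Y x (r *\<^sub>R y) = r * Y x y"
    and balanced: "\<And>a x y. Y (a *\<^sub>C x) y = Y x (cnj a *\<^sub>C y)"
    and bound: "\<And>x y. \<bar>Y x y\<bar> \<le> K * norm x * norm y"
  obtains T where "\<And>x y. Y x y = Re (cinner (T *\<^sub>V x) y)" "\<And>x. norm (T *\<^sub>V x) \<le> K * norm x"
proof -
  have "\<exists>u. \<forall>y. Y x y = Re (cinner y u)" for x
  proof -
    have "bounded_linear (Y x)"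
      by (rule bounded_linear_intro[where K = "K * norm x"])
        (use bound[of x] in \<open>simp_all add: add_right scaleR_right ac_simps\<close>)
    then obtain u where "\<And>y. Y x y = Re (cinner y u)" using riesz by blast
    then show ?thesis by blast
  qed
  then obtain u where u: "\<And>x y. Y x y = Re (cinner y (u x))" by metis
  have "u (x + x') = u x + u x'" for x x'
    by (rule Re_cinner_ext) (simp add: u[symmetric] cinner_simps add_left)
  moreover have "u (a *\<^sub>C x) = a *\<^sub>C u x" for a x
  proof (rule Re_cinner_ext)
    fix v
    have "Re (cinner v (u (a *\<^sub>C x))) = Re (cinner (cnj a *\<^sub>C v) (u x))"
      by (simp only: u[symmetric] balanced)
    then show "Re (cinner v (u (a *\<^sub>C x))) = Re (cinner v (a *\<^sub>C u x))"
      by (simp add: cinner_simps)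
  qed
  moreover have nu: "norm (u x) \<le> K * norm x" for x
  proof (cases "u x = 0")
    case True
    have "0 \<le> K * norm x * norm x" using bound[of x x] by linarith
    then show ?thesis using True by (cases "x = 0") (auto simp: zero_le_mult_iff)
  next
    case False
    have "norm (u x) * norm (u x) \<le> K * norm x * norm (u x)"
      using bound[of x "u x"] unfolding u Re_cinner_self power2_eq_square by simp
    then show ?thesis using False by simp
  qed
  ultimately obtain T where "\<And>x. T *\<^sub>V x = u x"
    using cblinfun_of_map[of u K] by blast
  then show ?thesis
    using nu by (intro that[of T]) (simp_all add: u Re_cinner_commute)
qed

lemma is_adjoint_if_Re:
  assumes "\<And>x y. Re (cinner (S *\<^sub>V x) y) = Re (cinner x (T *\<^sub>V y))"
  shows "is_adjoint S T"
  unfolding is_adjoint_def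
proof (intro allI)
  fix x y
  show "cinner (S *\<^sub>V x) y = cinner x (T *\<^sub>V y)"
    using assms[of x y] assms[of "\<i> *\<^sub>C x" y]
    by (intro complex_eqI) (simp_all add: cinner_simps cblinfun_simps)
qed

lemma is_adjoint_commute: "is_adjoint S T \<Longrightarrow> is_adjoint T S"
  unfolding is_adjoint_def by (metis cinner_commute)

lemma adjoint_exists:
  fixes T :: "'h::complex_hilbert \<Rightarrow>\<^sub>C\<^sub>L 'h"
  obtains S where "is_adjoint T S"
proof -
  obtain S where S: "\<And>x y. Re (cinner x (T *\<^sub>V y)) = Re (cinner (S *\<^sub>V x) y)"
  proof (rule operator_of_form[of "\<lambda>x y. Re (cinner x (T *\<^sub>V y))" "norm T"])
    fix x y :: 'h
    have "\<bar>Re (cinner x (T *\<^sub>V y))\<bar> \<le> norm x * norm (T *\<^sub>V y)"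
      using abs_Re_le_cmod cinner_cauchy_schwarz order_trans by blast
    also have "\<dots> \<le> norm x * (norm T * norm y)"
      by (intro mult_left_mono norm_cblinfun) simp
    finally show "\<bar>Re (cinner x (T *\<^sub>V y))\<bar> \<le> norm T * norm x * norm y" by (simp add: ac_simps)
  qed (auto simp: cinner_simps cblinfun_simps)
  then have "is_adjoint S T" by (intro is_adjoint_if_Re) simp
  then show ?thesis using that is_adjoint_commute by blast
qed

lemma norm_adjoint_le:
  assumes "is_adjoint x y"
  shows "norm y \<le> norm x"
proof (rule norm_cblinfun_bound)
  fix h
  have "norm (y *\<^sub>V h) * norm (y *\<^sub>V h) = Re (cinner (x *\<^sub>V (y *\<^sub>V h)) h)"
    using assms by (simp add: is_adjoint_def Re_cinner_self power2_eq_square)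
  also have "\<dots> \<le> norm (x *\<^sub>V (y *\<^sub>V h)) * norm h" by (rule Re_cinner_le)
  also have "\<dots> \<le> norm x * norm (y *\<^sub>V h) * norm h"
    by (intro mult_right_mono norm_cblinfun) simp
  finally show "norm (y *\<^sub>V h) \<le> norm x * norm h"
    by (cases "y *\<^sub>V h = 0") (auto simp: algebra_simps)
qed simp

lemma commutant_adjoint:
  assumes "star_subalgebra M" "t \<in> commutant M" "is_adjoint t t'"
  shows "t' \<in> commutant M"
  unfolding commutant_def
proof (intro CollectI ballI cblinfun_eqI)
  fix x h assume x: "x \<in> M"
  then obtain y where y: "y \<in> M" "is_adjoint x y"
    using assms(1) by (auto simp: star_subalgebra_def)
  have t: "t *\<^sub>V (y *\<^sub>V v) = y *\<^sub>V (t *\<^sub>V v)" for v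
  proof -
    have "(y o\<^sub>C\<^sub>L t) *\<^sub>V v = (t o\<^sub>C\<^sub>L y) *\<^sub>V v"
      using assms(2) y(1) by (simp add: commutant_def)
    then show ?thesis by simp
  qed
  have adj: "cinner v (t' *\<^sub>V w) = cinner (t *\<^sub>V v) w" "cinner v (x *\<^sub>V w) = cinner (y *\<^sub>V v) w" for v w
    using assms(3) is_adjoint_commute[OF y(2)] by (auto simp: is_adjoint_def)
  show "(x o\<^sub>C\<^sub>L t') *\<^sub>V h = (t' o\<^sub>C\<^sub>L x) *\<^sub>V h"
    by (rule Re_cinner_ext) (simp add: adj t)
qed

section \<open>Resolvents of closed positive forms\<close>

context closed_positive_form
begin

lemma shifted_commute: "u \<in> C \<Longrightarrow> v \<in> C \<Longrightarrow> shifted u v = cnj (shifted v u)"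
  using B_commute[of u v] cinner_commute[of u v] by (simp add: shifted_def)

text \<open>
  The operator \<open>R = (1 + B)\<^sup>-\<^sup>1\<close>, described weakly. For \<open>B = 0\<close> it is the orthogonal projection
  onto \<open>C\<close>.
\<close>

theorem resolvent:
  obtains R :: "'h \<Rightarrow>\<^sub>C\<^sub>L 'h" where
    "\<And>h. R *\<^sub>V h \<in> C"
    "\<And>h v. v \<in> C \<Longrightarrow> cinner v (R *\<^sub>V h) + B v (R *\<^sub>V h) = cinner v h"
proof -
  have "\<exists>u\<in>C. \<forall>v\<in>C. shifted v u = cinner v h" for h
  proof -
    have "bounded_linear (\<lambda>v. Re (cinner v h))"
      by (rule bounded_linear_compose[OF bounded_linear_Re bounded_linear_cinner_left])
    then obtain u where u: "u \<in> C" "\<And>v. v \<in> C \<Longrightarrow> Re (shifted v u) = Re (cinner v h)"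
      using riesz_closed_form by blast
    \<comment> \<open>Testing with \<open>\<i> v\<close> recovers the imaginary parts.\<close>
    have "shifted v u = cinner v h" if "v \<in> C" for v
      using u(2)[OF that] u(2)[OF scale_C[OF that, of \<i>]] shifted_scaleC_left[OF that u(1), of \<i>]
      by (intro complex_eqI) (simp_all add: cinner_simps)
    then show ?thesis using u(1) by blast
  qed
  then obtain r where r: "\<And>h. r h \<in> C" "\<And>h v. v \<in> C \<Longrightarrow> shifted v (r h) = cinner v h" by metis
  have add: "r (x + y) = r x + r y" for x y
  proof (rule riesz_closed_form_unique)
    fix v assume v: "v \<in> C"
    have "shifted v (r x + r y) = shifted v (r x) + shifted v (r y)"
      using shifted_commute[OF v r(1)] shifted_commute[OF v add_C[OF r(1) r(1)]] shifted_add_left[OF r(1) r(1) v]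
      by simp
    then show "shifted v (r (x + y)) = shifted v (r x + r y)"
      using v by (simp add: r(2) cinner_simps)
  qed (auto intro: r add_C)
  moreover have scale: "r (a *\<^sub>C x) = a *\<^sub>C r x" for a x
  proof (rule riesz_closed_form_unique)
    fix v assume v: "v \<in> C"
    have "shifted v (a *\<^sub>C r x) = cnj a * shifted v (r x)"
      using shifted_commute[OF v r(1)] shifted_commute[OF v scale_C[OF r(1)]] shifted_scaleC_left[OF r(1) v]
      by simp
    then show "shifted v (r (a *\<^sub>C x)) = shifted v (a *\<^sub>C r x)"
      using v by (simp add: r(2) cinner_simps)
  qed (auto intro: r scale_C)
  moreover have "norm (r x) \<le> 1 * norm x" for x
  proof (cases "r x = 0")
    case False
    have "norm (r x) * norm (r x) \<le> Re (shifted (r x) (r x))"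
      using norm_le_Re_shifted[OF r(1)[of x]] by (simp add: power2_eq_square)
    also have "\<dots> \<le> norm (r x) * norm x"
      using r(2)[OF r(1)[of x]] Re_cinner_le by simp
    finally show ?thesis using False by simp
  qed simp
  ultimately obtain R where "\<And>x. R *\<^sub>V x = r x" using cblinfun_of_map[of r 1] by blast
  then show ?thesis using r that[of R] by (simp add: shifted_def)
qed

context
  fixes R :: "'h \<Rightarrow>\<^sub>C\<^sub>L 'h"
  assumes R_C: "R *\<^sub>V h \<in> C"
    and R_eq: "v \<in> C \<Longrightarrow> cinner v (R *\<^sub>V h) + B v (R *\<^sub>V h) = cinner v h"
begin

lemma shifted_R: "v \<in> C \<Longrightarrow> shifted v (R *\<^sub>V h) = cinner v h"
  using R_eq by (simp add: shifted_def)

lemma norm_resolvent_le: "norm (R *\<^sub>V h) \<le> norm h"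
proof (cases "R *\<^sub>V h = 0")
  case False
  have "norm (R *\<^sub>V h) * norm (R *\<^sub>V h) \<le> Re (shifted (R *\<^sub>V h) (R *\<^sub>V h))"
    using norm_le_Re_shifted[OF R_C[of h]] by (simp add: power2_eq_square)
  also have "\<dots> \<le> norm (R *\<^sub>V h) * norm h"
    using shifted_R[OF R_C[of h]] Re_cinner_le by simp
  finally show ?thesis using False by simp
qed simp

lemma form_resolvent_le: "Re (B (R *\<^sub>V h) (R *\<^sub>V h)) \<le> (norm h)\<^sup>2"
proof -
  have "Re (B (R *\<^sub>V h) (R *\<^sub>V h)) \<le> Re (shifted (R *\<^sub>V h) (R *\<^sub>V h))"
    by (simp add: shifted_def Re_cinner_self)
  also have "\<dots> \<le> norm (R *\<^sub>V h) * norm h"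
    using shifted_R[OF R_C[of h]] Re_cinner_le by simp
  also have "\<dots> \<le> norm h * norm h"
    by (intro mult_right_mono norm_resolvent_le) simp
  finally show ?thesis by (simp add: power2_eq_square)
qed

lemma resolvent_near_identity:
  assumes x: "x \<in> C"
  shows "(norm (R *\<^sub>V x - x))\<^sup>2 \<le> Re (B x x)"
proof -
  \<comment> \<open>The squared distance is at most the shifted energy of \<open>x - R x\<close>, which the weak equation evaluates.\<close>
  let ?u = "R *\<^sub>V x"
  have "(norm (x - ?u))\<^sup>2 \<le> Re (shifted (x - ?u) (x - ?u))"
    by (rule norm_le_Re_shifted) (simp add: diff_C x R_C)
  also have "\<dots> = Re (shifted x x) - 2 * Re (shifted ?u x) + Re (shifted ?u ?u)"
    using Re_shifted_expand[OF x R_C[of x], of "- 1"] by simp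
  also have "Re (shifted ?u x) = (norm x)\<^sup>2"
    using Re_shifted_commute[OF R_C[of x] x] shifted_R[OF x] by (simp add: Re_cinner_self)
  also have "Re (shifted ?u ?u) \<le> norm x * norm x"
    using shifted_R[OF R_C[of x], of x] Re_cinner_le[of ?u x]
      mult_right_mono[OF norm_resolvent_le[of x] norm_ge_zero[of x]] by simp
  also have "Re (shifted x x) = (norm x)\<^sup>2 + Re (B x x)" by (simp add: shifted_def Re_cinner_self)
  finally show ?thesis by (simp add: norm_minus_commute power2_eq_square)
qed

text \<open>
  By uniqueness: \<open>t (R h)\<close> and \<open>R (t h)\<close> solve the same weak equation.
\<close>

lemma resolvent_commutes:
  assumes t: "is_adjoint t' t"
    and inv: "\<And>u. u \<in> C \<Longrightarrow> t *\<^sub>V u \<in> C" "\<And>u. u \<in> C \<Longrightarrow> t' *\<^sub>V u \<in> C"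
    and B: "\<And>u v. u \<in> C \<Longrightarrow> v \<in> C \<Longrightarrow> B v (t *\<^sub>V u) = B (t' *\<^sub>V v) u"
  shows "t o\<^sub>C\<^sub>L R = R o\<^sub>C\<^sub>L t"
proof (rule cblinfun_eqI)
  fix h
  have "t *\<^sub>V (R *\<^sub>V h) = R *\<^sub>V (t *\<^sub>V h)"
  proof (rule riesz_closed_form_unique)
    fix v assume v: "v \<in> C"
    have "shifted v (t *\<^sub>V (R *\<^sub>V h)) = shifted (t' *\<^sub>V v) (R *\<^sub>V h)"
      using t B[OF R_C v] by (simp add: shifted_def is_adjoint_def)
    also have "\<dots> = shifted v (R *\<^sub>V (t *\<^sub>V h))"
      using t v by (simp add: shifted_R inv is_adjoint_def)
    finally show "shifted v (t *\<^sub>V (R *\<^sub>V h)) = shifted v (R *\<^sub>V (t *\<^sub>V h))" .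
  qed (auto intro: inv R_C)
  then show "(t o\<^sub>C\<^sub>L R) *\<^sub>V h = (R o\<^sub>C\<^sub>L t) *\<^sub>V h" by simp
qed

text \<open>
  A form that is invariant under the commutant has its resolvent in the bicommutant.
\<close>

lemma resolvent_in_von_neumann_algebra:
  assumes M: "von_neumann_algebra M"
    and inv: "\<And>t u. t \<in> commutant M \<Longrightarrow> u \<in> C \<Longrightarrow> t *\<^sub>V u \<in> C"
    and B: "\<And>t t' u v. t \<in> commutant M \<Longrightarrow> t' \<in> commutant M \<Longrightarrow> is_adjoint t' t
      \<Longrightarrow> u \<in> C \<Longrightarrow> v \<in> C \<Longrightarrow> B v (t *\<^sub>V u) = B (t' *\<^sub>V v) u"
  shows "R \<in> M"
proof -
  have "t o\<^sub>C\<^sub>L R = R o\<^sub>C\<^sub>L t" if t: "t \<in> commutant M" for t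
  proof -
    obtain t' where "is_adjoint t t'" by (rule adjoint_exists)
    then have t': "is_adjoint t' t" "t' \<in> commutant M"
      using M t commutant_adjoint is_adjoint_commute by (auto simp: von_neumann_algebra_def)
    show ?thesis
      by (rule resolvent_commutes[OF t'(1)]) (use t t' inv B in auto)
  qed
  then have "R \<in> commutant (commutant M)" by (auto simp: commutant_def)
  then show ?thesis using M by (simp add: von_neumann_algebra_def)
qed

end

end

section \<open>Projections and compressors in a von Neumann algebra\<close>

lemma commutant_commute: "x \<in> M \<Longrightarrow> t \<in> commutant M \<Longrightarrow> x *\<^sub>V (t *\<^sub>V h) = t *\<^sub>V (x *\<^sub>V h)"
  unfolding commutant_def by (metis (mono_tags, lifting) cblinfun_compose_apply mem_Collect_eq)

text \<open>
  For a von Neumann algebra this is the closure of the span of the vectors \<open>t \<xi>\<close> with \<open>t\<close> in the commutant and \<open>\<xi> \<in> D\<close>.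
  Describing it through annihilators makes it evident that it is closed, that it is invariant under the
  commutant, and that an element of \<open>M\<close> killing \<open>D\<close> kills it.
\<close>

definition annihilated_hull :: "('h::complex_hilbert \<Rightarrow>\<^sub>C\<^sub>L 'h) set \<Rightarrow> 'h set \<Rightarrow> 'h set"
  where "annihilated_hull M D = {v. \<forall>w\<in>M. (\<forall>\<xi>\<in>D. w *\<^sub>V \<xi> = 0) \<longrightarrow> w *\<^sub>V v = 0}"

lemma annihilated_hull_superset: "D \<subseteq> annihilated_hull M D"
  by (auto simp: annihilated_hull_def)

lemma annihilated_hull_mono: "D \<subseteq> D' \<Longrightarrow> annihilated_hull M D \<subseteq> annihilated_hull M D'"
  by (auto simp: annihilated_hull_def)

lemma hull_projection_exists:
  assumes "von_neumann_algebra M"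
  shows "\<exists>p\<in>M. (\<forall>h. p *\<^sub>V h \<in> annihilated_hull M D) \<and>
    (\<forall>h. \<forall>v\<in>annihilated_hull M D. cinner v (p *\<^sub>V h) = cinner v h)"
proof -
  let ?C = "annihilated_hull M D"
  interpret closed_positive_form ?C "\<lambda>_ _. 0"
  proof
    fix s :: "nat \<Rightarrow> 'a" and u m
    assume s: "\<And>n. s n \<in> ?C" "s \<longlonglongrightarrow> u" and m: "(\<lambda>n. Re 0) \<longlonglongrightarrow> m"
    have "w *\<^sub>V u = 0" if "w \<in> M" "\<forall>\<xi>\<in>D. w *\<^sub>V \<xi> = 0" for w
    proof (rule LIMSEQ_unique)
      show "(\<lambda>n. w *\<^sub>V s n) \<longlonglongrightarrow> w *\<^sub>V u"
        by (rule bounded_linear.tendsto[OF bounded_linear_cblinfun s(2)])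
      show "(\<lambda>n. w *\<^sub>V s n) \<longlonglongrightarrow> 0"
        using s(1) that by (simp add: annihilated_hull_def)
    qed
    then show "u \<in> ?C \<and> Re 0 \<le> m"
      using LIMSEQ_unique[OF m tendsto_const] by (simp add: annihilated_hull_def)
  qed (auto simp: annihilated_hull_def cblinfun_simps scaleC_zero_right)
  obtain R where R: "\<And>h. R *\<^sub>V h \<in> ?C" "\<And>h v. v \<in> ?C \<Longrightarrow> cinner v (R *\<^sub>V h) + 0 = cinner v h"
    by (rule resolvent) blast
  have "R \<in> M"
  proof (rule resolvent_in_von_neumann_algebra[OF R assms])
    show "t *\<^sub>V u \<in> ?C" if "t \<in> commutant M" "u \<in> ?C" for t u
      using that(2) by (auto simp: annihilated_hull_def commutant_commute[OF _ that(1)] cblinfun_simps)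
  qed simp_all
  then show ?thesis using R by auto
qed

definition hull_projection :: "('h::complex_hilbert \<Rightarrow>\<^sub>C\<^sub>L 'h) set \<Rightarrow> 'h set \<Rightarrow> ('h \<Rightarrow>\<^sub>C\<^sub>L 'h)"
  where "hull_projection M D = (SOME p. p \<in> M \<and> (\<forall>h. p *\<^sub>V h \<in> annihilated_hull M D) \<and>
    (\<forall>h. \<forall>v\<in>annihilated_hull M D. cinner v (p *\<^sub>V h) = cinner v h))"

lemma
  assumes "von_neumann_algebra M"
  shows hull_projection_mem: "hull_projection M D \<in> M"
    and hull_projection_range: "hull_projection M D *\<^sub>V h \<in> annihilated_hull M D"
    and cinner_hull_projection:
      "v \<in> annihilated_hull M D \<Longrightarrow> cinner v (hull_projection M D *\<^sub>V h) = cinner v h"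
  using someI_ex[OF hull_projection_exists[OF assms, of D, unfolded Bex_def]]
  unfolding hull_projection_def by blast+

lemma hull_projection_annihilates:
  assumes "von_neumann_algebra M" "w \<in> M" "\<And>\<xi>. \<xi> \<in> D \<Longrightarrow> w *\<^sub>V \<xi> = 0"
  shows "w *\<^sub>V (hull_projection M D *\<^sub>V h) = 0"
  using hull_projection_range[OF assms(1), of D h] assms(2,3) by (simp add: annihilated_hull_def)

text \<open>
  Pythagoras, for nested subspaces. It makes the increments along a chain of hulls telescope.
\<close>

lemma hull_projection_norm_diff:
  assumes M: "von_neumann_algebra M" and sub: "D \<subseteq> D'"
  shows "(norm (hull_projection M D' *\<^sub>V h - hull_projection M D *\<^sub>V h))\<^sup>2
    = (norm (hull_projection M D' *\<^sub>V h))\<^sup>2 - (norm (hull_projection M D *\<^sub>V h))\<^sup>2"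
proof -
  let ?p = "hull_projection M D *\<^sub>V h" and ?p' = "hull_projection M D' *\<^sub>V h"
  have "?p \<in> annihilated_hull M D" "?p \<in> annihilated_hull M D'"
    using hull_projection_range[OF M] annihilated_hull_mono[OF sub] by blast+
  then have "cinner ?p (?p' - ?p) = 0"
    by (simp add: cinner_hull_projection[OF M] cinner_simps)
  then show ?thesis
    using norm_add_square[of ?p "?p' - ?p"] by simp
qed

lemma norm_hull_projection_le:
  assumes M: "von_neumann_algebra M"
  shows "norm (hull_projection M D *\<^sub>V h) \<le> norm h"
proof -
  let ?p = "hull_projection M D *\<^sub>V h"
  have "cinner ?p ?p = cinner ?p h"
    by (rule cinner_hull_projection[OF M hull_projection_range[OF M]])
  then have "norm ?p * norm ?p \<le> norm ?p * norm h"
    using Re_cinner_le[of ?p h] by (metis Re_cinner_self power2_eq_square)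
  then show ?thesis by (cases "?p = 0") auto
qed

lemma hull_projection_fixes:
  assumes M: "von_neumann_algebra M" and v: "v \<in> annihilated_hull M D"
  shows "hull_projection M D *\<^sub>V v = v"
proof -
  let ?p = "hull_projection M D *\<^sub>V v"
  have "cinner ?p ?p = cinner ?p v" "cinner v ?p = cinner v v"
    using cinner_hull_projection[OF M] hull_projection_range[OF M] v by blast+
  then have "cinner (?p - v) (?p - v) = 0" by (simp add: cinner_simps)
  then show ?thesis using cinner_self[of "?p - v"] by simp
qed

lemma hull_projection_absorbs:
  assumes M: "von_neumann_algebra M" and "D \<subseteq> D'"
  shows "hull_projection M D' o\<^sub>C\<^sub>L hull_projection M D = hull_projection M D"
  using hull_projection_fixes[OF M] hull_projection_range[OF M] annihilated_hull_mono[OF assms(2)]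
  by (intro cblinfun_eqI) (auto simp: subset_iff)

lemma norm_add_square_le: "(norm (x + y))\<^sup>2 \<le> 2 * (norm x)\<^sup>2 + 2 * (norm y)\<^sup>2"
  for x y :: "'a::real_normed_vector"
proof -
  have "(norm (x + y))\<^sup>2 \<le> (norm x + norm y)\<^sup>2"
    by (intro power_mono norm_triangle_ineq norm_ge_zero)
  also have "\<dots> \<le> 2 * (norm x)\<^sup>2 + 2 * (norm y)\<^sup>2"
    using sum_squares_bound[of "norm x" "norm y"] by (simp add: power2_sum)
  finally show ?thesis .
qed

text \<open>
  The operator \<open>a\<close> is the resolvent of the form \<open>(\<Sum>k. \<langle>y\<^sub>k u, y\<^sub>k v\<rangle>)\<close> on the subspace where
  \<open>(\<Sum>k. \<parallel>y\<^sub>k u\<parallel>\<^sup>2)\<close> converges, formally \<open>(1 + \<Sum>k. y\<^sub>k\<^sup>* y\<^sub>k)\<^sup>-\<^sup>1\<close>. It makes all \<open>y\<^sub>k\<close> contractive at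
  once and moves a vector little if the \<open>y\<^sub>k\<close> are jointly small on it: a noncommutative substitute for
  Egorov's theorem, in which \<open>a\<close> replaces the indicator function of a large set.
\<close>

theorem compressor_exists:
  fixes y :: "nat \<Rightarrow> ('h::complex_hilbert \<Rightarrow>\<^sub>C\<^sub>L 'h)"
  assumes M: "von_neumann_algebra M" and y: "\<And>k. y k \<in> M"
  obtains a where "a \<in> M"
    "\<And>k h. norm (y k *\<^sub>V (a *\<^sub>V h)) \<le> norm h"
    "\<And>\<xi>. summable (\<lambda>k. (norm (y k *\<^sub>V \<xi>))\<^sup>2) \<Longrightarrow>
       (norm (a *\<^sub>V \<xi> - \<xi>))\<^sup>2 \<le> (\<Sum>k. (norm (y k *\<^sub>V \<xi>))\<^sup>2)"
proof -
  define C where "C = {u. summable (\<lambda>k. (norm (y k *\<^sub>V u))\<^sup>2)}"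
  define B where "B u v = (\<Sum>k. cinner (y k *\<^sub>V u) (y k *\<^sub>V v))" for u v
  have summ: "summable (\<lambda>k. cinner (y k *\<^sub>V u) (y k *\<^sub>V v))" if "u \<in> C" "v \<in> C" for u v
  proof (rule summable_comparison_test')
    show "summable (\<lambda>k. (norm (y k *\<^sub>V u))\<^sup>2 + (norm (y k *\<^sub>V v))\<^sup>2)"
      using that by (simp add: C_def summable_add)
    show "norm (cinner (y k *\<^sub>V u) (y k *\<^sub>V v)) \<le> (norm (y k *\<^sub>V u))\<^sup>2 + (norm (y k *\<^sub>V v))\<^sup>2" for k
      using cinner_cauchy_schwarz[of "y k *\<^sub>V u" "y k *\<^sub>V v"]
        sum_squares_bound[of "norm (y k *\<^sub>V u)" "norm (y k *\<^sub>V v)"]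
        mult_nonneg_nonneg[of "norm (y k *\<^sub>V u)" "norm (y k *\<^sub>V v)"]
      by (simp del: mult_nonneg_nonneg)
  qed
  have ReB: "Re (B u u) = (\<Sum>k. (norm (y k *\<^sub>V u))\<^sup>2)" if "u \<in> C" for u
    unfolding B_def bounded_linear.suminf[OF bounded_linear_Re summ[OF that that]]
    by (simp add: Re_cinner_self)
  interpret closed_positive_form C B
  proof
    show "0 \<in> C" by (simp add: C_def cblinfun_simps)
    show "u + v \<in> C" if "u \<in> C" "v \<in> C" for u v
      unfolding C_def
    proof (rule CollectI, rule summable_comparison_test')
      show "summable (\<lambda>k. 2 * (norm (y k *\<^sub>V u))\<^sup>2 + 2 * (norm (y k *\<^sub>V v))\<^sup>2)"
        using that by (simp add: C_def summable_add summable_mult)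
      show "norm ((norm (y k *\<^sub>V (u + v)))\<^sup>2) \<le> 2 * (norm (y k *\<^sub>V u))\<^sup>2 + 2 * (norm (y k *\<^sub>V v))\<^sup>2" for k
        by (simp add: cblinfun_simps norm_add_square_le)
    qed
    show "a *\<^sub>C u \<in> C" if "u \<in> C" for u a
      using that by (simp add: C_def cblinfun_simps norm_scaleC power_mult_distrib summable_mult)
    show "B (u + v) w = B u w + B v w" if "u \<in> C" "v \<in> C" "w \<in> C" for u v w
      unfolding B_def using suminf_add[OF summ[OF that(1,3)] summ[OF that(2,3)]]
      by (simp add: cblinfun_simps cinner_simps)
    show "B (a *\<^sub>C u) v = a * B u v" if "u \<in> C" "v \<in> C" for u v a
      unfolding B_def using suminf_mult[OF summ[OF that], of a]
      by (simp add: cblinfun_simps cinner_simps)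
    show "B u v = cnj (B v u)" if "u \<in> C" "v \<in> C" for u v
      unfolding B_def bounded_linear.suminf[OF bounded_linear_cnj summ[OF that(2,1)]]
      by (simp add: cinner_commute[symmetric])
    show "0 \<le> Re (B u u)" if "u \<in> C" for u
      unfolding ReB[OF that] using that by (intro suminf_nonneg) (simp_all add: C_def)
    fix s :: "nat \<Rightarrow> 'h" and u m
    assume s: "\<And>n. s n \<in> C" "s \<longlonglongrightarrow> u" and m: "(\<lambda>n. Re (B (s n) (s n))) \<longlonglongrightarrow> m"
    have part: "(\<Sum>k<N. (norm (y k *\<^sub>V u))\<^sup>2) \<le> m" for N
    proof (rule LIMSEQ_le)
      show "(\<lambda>n. \<Sum>k<N. (norm (y k *\<^sub>V s n))\<^sup>2) \<longlonglongrightarrow> (\<Sum>k<N. (norm (y k *\<^sub>V u))\<^sup>2)"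
        by (intro tendsto_intros bounded_linear.tendsto[OF bounded_linear_cblinfun] s(2))
      have "(\<Sum>k<N. (norm (y k *\<^sub>V s n))\<^sup>2) \<le> Re (B (s n) (s n))" for n
        unfolding ReB[OF s(1)] using s(1)[of n] by (intro sum_le_suminf) (auto simp: C_def)
      then show "\<exists>n0. \<forall>n\<ge>n0. (\<Sum>k<N. (norm (y k *\<^sub>V s n))\<^sup>2) \<le> Re (B (s n) (s n))" by blast
    qed (fact m)
    then have "u \<in> C"
      unfolding C_def by (auto intro!: summableI_nonneg_bounded[of _ m])
    moreover from this have "Re (B u u) \<le> m"
      unfolding ReB[OF \<open>u \<in> C\<close>] using part by (intro suminf_le_const) (simp_all add: C_def)
    ultimately show "u \<in> C \<and> Re (B u u) \<le> m" ..
  qed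
  obtain R where R: "\<And>h. R *\<^sub>V h \<in> C" "\<And>h v. v \<in> C \<Longrightarrow> cinner v (R *\<^sub>V h) + B v (R *\<^sub>V h) = cinner v h"
    by (rule resolvent) blast
  show ?thesis
  proof (rule that[of R])
    show "R \<in> M"
    proof (rule resolvent_in_von_neumann_algebra[OF R M])
      fix t u assume t: "t \<in> commutant M" and u: "u \<in> C"
      have "norm ((norm (y k *\<^sub>V (t *\<^sub>V u)))\<^sup>2) \<le> (norm t)\<^sup>2 * (norm (y k *\<^sub>V u))\<^sup>2" for k
        using norm_cblinfun[of t "y k *\<^sub>V u"]
        by (simp add: commutant_commute[OF y t] power_mult_distrib[symmetric] power_mono)
      then show "t *\<^sub>V u \<in> C"
        using u unfolding C_def
        by (auto intro!: summable_comparison_test'[of "\<lambda>k. (norm t)\<^sup>2 * (norm (y k *\<^sub>V u))\<^sup>2"] summable_mult)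
    next
      show "B v (t *\<^sub>V u) = B (t' *\<^sub>V v) u"
        if "t \<in> commutant M" "t' \<in> commutant M" "is_adjoint t' t" for t t' u v
        using that(3) by (simp add: B_def commutant_commute[OF y that(1)]
            commutant_commute[OF y that(2)] is_adjoint_def)
    qed
    show "norm (y k *\<^sub>V (R *\<^sub>V h)) \<le> norm h" for k h
    proof (rule power2_le_imp_le)
      have "(norm (y k *\<^sub>V (R *\<^sub>V h)))\<^sup>2 = (\<Sum>j\<in>{k}. (norm (y j *\<^sub>V (R *\<^sub>V h)))\<^sup>2)" by simp
      also have "\<dots> \<le> (\<Sum>j. (norm (y j *\<^sub>V (R *\<^sub>V h)))\<^sup>2)"
        using R(1)[of h] by (intro sum_le_suminf) (auto simp: C_def)
      also have "\<dots> \<le> (norm h)\<^sup>2"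
        using form_resolvent_le[OF R, of h] ReB[OF R(1)] by simp
      finally show "(norm (y k *\<^sub>V (R *\<^sub>V h)))\<^sup>2 \<le> (norm h)\<^sup>2" .
    qed simp
    show "(norm (R *\<^sub>V \<xi> - \<xi>))\<^sup>2 \<le> (\<Sum>k. (norm (y k *\<^sub>V \<xi>))\<^sup>2)"
      if "summable (\<lambda>k. (norm (y k *\<^sub>V \<xi>))\<^sup>2)" for \<xi>
      using resolvent_near_identity[OF R, of \<xi>] that ReB[of \<xi>] by (simp add: C_def)
  qed
qed

section \<open>Finite sums of vector functionals\<close>

text \<open>
  Lists of pairs of vectors represent finite-rank tensors; sums of tensors become concatenations.
\<close>

definition vector_sum :: "('h::complex_hilbert \<times> 'h) list \<Rightarrow> ('h \<Rightarrow>\<^sub>C\<^sub>L 'h) \<Rightarrow> complex"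
  where "vector_sum L x = (\<Sum>(\<xi>, \<eta>)\<leftarrow>L. cinner (x *\<^sub>V \<xi>) \<eta>)"

text \<open>
  An upper bound for the norm of the functional; the projective tensor norm is its infimum over all
  representations.
\<close>

definition cost :: "('h::complex_hilbert \<times> 'h) list \<Rightarrow> real"
  where "cost L = (\<Sum>(\<xi>, \<eta>)\<leftarrow>L. norm \<xi> * norm \<eta>)"

lemma vector_sum_simps [simp]:
  "vector_sum [] x = 0"
  "vector_sum ((\<xi>, \<eta>) # L) x = cinner (x *\<^sub>V \<xi>) \<eta> + vector_sum L x"
  "vector_sum (L @ L') x = vector_sum L x + vector_sum L' x"
  by (simp_all add: vector_sum_def)

lemma cost_simps [simp]:
  "cost [] = 0" "cost ((\<xi>, \<eta>) # L) = norm \<xi> * norm \<eta> + cost L" "cost (L @ L') = cost L + cost L'"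
  by (simp_all add: cost_def)

lemma cost_nonneg: "0 \<le> cost L"
  by (induction L) auto

lemma vector_sum_scaleC: "vector_sum L (a *\<^sub>C x) = a * vector_sum L x"
  by (induction L) (auto simp: cblinfun_simps cinner_simps algebra_simps)

definition scale_list :: "real \<Rightarrow> ('h::complex_hilbert \<times> 'h) list \<Rightarrow> ('h \<times> 'h) list"
  where "scale_list r = map (\<lambda>(\<xi>, \<eta>). (r *\<^sub>R \<xi>, \<eta>))"

lemma vector_sum_scale_list: "vector_sum (scale_list r L) x = of_real r * vector_sum L x"
  by (induction L) (auto simp: scale_list_def cblinfun_simps cinner_simps algebra_simps)

lemma cost_scale_list: "cost (scale_list r L) = \<bar>r\<bar> * cost L"
  by (induction L) (auto simp: scale_list_def algebra_simps)

lemma cmod_vector_sum_le: "cmod (vector_sum L x) \<le> cost L * norm x"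
proof (induction L)
  case (Cons a L)
  obtain \<xi> \<eta> where a: "a = (\<xi>, \<eta>)" by fastforce
  have "cmod (cinner (x *\<^sub>V \<xi>) \<eta>) \<le> norm (x *\<^sub>V \<xi>) * norm \<eta>" by (rule cinner_cauchy_schwarz)
  also have "\<dots> \<le> norm x * norm \<xi> * norm \<eta>" by (intro mult_right_mono norm_cblinfun) simp
  finally have "cmod (cinner (x *\<^sub>V \<xi>) \<eta> + vector_sum L x) \<le> norm x * norm \<xi> * norm \<eta> + cost L * norm x"
    using Cons.IH by (intro norm_triangle_le) linarith
  then show ?case by (simp add: a algebra_simps)
qed simp

text \<open>
  The vectors of \<open>D\<close> are removed one at a time. For a vector \<open>\<xi>\<close>, the Mazur-Orlicz theorem yields a
  linear functional on the Hilbert space that is bounded by the norm and, along \<open>x \<mapsto> x \<xi>\<close>, dominates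
  what exceeds the remaining terms. By Riesz it is an inner product, and subtracting it leaves a
  functional that is estimated by one vector less.
\<close>

lemma real_approximation_by_vector_sum:
  fixes M :: "('h::complex_hilbert \<Rightarrow>\<^sub>C\<^sub>L 'h) set"
  assumes M: "0 \<in> M" "\<And>x y. x \<in> M \<Longrightarrow> y \<in> M \<Longrightarrow> x + y \<in> M" "\<And>r x. x \<in> M \<Longrightarrow> r *\<^sub>R x \<in> M"
    and F: "\<And>x y. x \<in> M \<Longrightarrow> y \<in> M \<Longrightarrow> F (x + y) = F x + F y"
      "\<And>r x. x \<in> M \<Longrightarrow> F (r *\<^sub>R x) = r * F x"
    and \<epsilon>: "\<epsilon> \<ge> 0"
    and le: "\<And>x. x \<in> M \<Longrightarrow> F x \<le> \<epsilon> * norm x + (\<Sum>\<xi>\<leftarrow>D. norm (x *\<^sub>V \<xi>))"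
  shows "\<exists>L. \<forall>x\<in>M. F x - Re (vector_sum L x) \<le> \<epsilon> * norm x"
  using F le
proof (induction D arbitrary: F)
  case Nil
  then show ?case by (intro exI[of _ "[]"]) simp
next
  case (Cons \<xi> D)
  let ?N = "\<lambda>x. \<epsilon> * norm x + (\<Sum>\<xi>\<leftarrow>D. norm (x *\<^sub>V \<xi>))"
  have N_add: "?N (x + y) \<le> ?N x + ?N y" for x y
  proof -
    have "(\<Sum>\<xi>\<leftarrow>D. norm ((x + y) *\<^sub>V \<xi>)) \<le> (\<Sum>\<xi>\<leftarrow>D. norm (x *\<^sub>V \<xi>) + norm (y *\<^sub>V \<xi>))"
      by (intro sum_list_mono) (simp add: cblinfun_simps norm_triangle_ineq)
    moreover have "\<epsilon> * norm (x + y) \<le> \<epsilon> * (norm x + norm y)"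
      using \<epsilon> by (intro mult_left_mono norm_triangle_ineq)
    ultimately show ?thesis by (simp add: sum_list_addf algebra_simps)
  qed
  have N_scale: "?N (r *\<^sub>R x) = r * ?N x" if "r > 0" for r x
    using that by (simp add: cblinfun_simps sum_list_const_mult algebra_simps)
  have N_zero: "?N 0 = 0"
    using N_scale[of 2 0] by simp
  obtain l where l: "linear l" "\<And>h. l h \<le> norm h" "\<And>x. x \<in> M \<Longrightarrow> F x - ?N x \<le> l (x *\<^sub>V \<xi>)"
  proof (rule mazur_orlicz[of norm M "\<lambda>x. x *\<^sub>V \<xi>" "\<lambda>x. F x - ?N x"])
    show "sublinear (norm :: 'h \<Rightarrow> real)"
      by (simp add: sublinear_def norm_triangle_ineq)
    show "F x - ?N x + (F y - ?N y) \<le> F (x + y) - ?N (x + y)" if "x \<in> M" "y \<in> M" for x y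
      using N_add[of x y] Cons.prems(1)[OF that] by linarith
    show "t * (F x - ?N x) \<le> F (t *\<^sub>R x) - ?N (t *\<^sub>R x)" if "t > 0" "x \<in> M" for t x
      unfolding N_scale[OF that(1)] Cons.prems(2)[OF that(2)] by (simp add: algebra_simps)
    show "F x - ?N x \<le> norm (x *\<^sub>V \<xi>)" if "x \<in> M" for x
      using Cons.prems(3)[OF that] by simp
    show "F 0 - ?N 0 = 0"
      using N_zero Cons.prems(2)[OF M(1), of 0] by simp
  qed (use M in \<open>auto simp: cblinfun_simps\<close>)
  have "bounded_linear l"
  proof (rule bounded_linear_intro[where K = 1])
    show "norm (l h) \<le> norm h * 1" for h
      using l(2)[of h] l(2)[of "- h"] linear_neg[OF l(1), of h] by simp
  qed (use l(1) in \<open>auto simp: linear_add linear_scale\<close>)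
  then obtain u where u: "\<And>h. l h = Re (cinner h u)" using riesz by blast
  have "\<exists>L. \<forall>x\<in>M. (F x - Re (cinner (x *\<^sub>V \<xi>) u)) - Re (vector_sum L x) \<le> \<epsilon> * norm x"
  proof (rule Cons.IH)
    show "F x - Re (cinner (x *\<^sub>V \<xi>) u) \<le> ?N x" if "x \<in> M" for x
      using l(3)[OF that] by (simp add: u)
  qed (auto simp: Cons.prems cblinfun_simps cinner_simps algebra_simps)
  then obtain L where "\<forall>x\<in>M. (F x - Re (cinner (x *\<^sub>V \<xi>) u)) - Re (vector_sum L x) \<le> \<epsilon> * norm x" ..
  then have "\<forall>x\<in>M. F x - Re (vector_sum ((\<xi>, u) # L) x) \<le> \<epsilon> * norm x" by (simp add: algebra_simps)
  then show ?case by blast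
qed

lemma approximation_by_vector_sum:
  fixes M :: "('h::complex_hilbert \<Rightarrow>\<^sub>C\<^sub>L 'h) set"
  assumes M: "star_subalgebra M"
    and f: "\<And>x y. x \<in> M \<Longrightarrow> y \<in> M \<Longrightarrow> f (x + y) = f x + f y"
      "\<And>a x. x \<in> M \<Longrightarrow> f (a *\<^sub>C x) = a * f x"
    and \<epsilon>: "\<epsilon> \<ge> 0"
    and le: "\<And>x. x \<in> M \<Longrightarrow> cmod (f x) \<le> \<epsilon> * norm x + (\<Sum>\<xi>\<leftarrow>D. norm (x *\<^sub>V \<xi>))"
  shows "\<exists>L. \<forall>x\<in>M. cmod (f x - vector_sum L x) \<le> \<epsilon> * norm x"
proof -
  have "\<exists>L. \<forall>x\<in>M. Re (f x) - Re (vector_sum L x) \<le> \<epsilon> * norm x"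
  proof (rule real_approximation_by_vector_sum[OF _ _ _ _ _ \<epsilon>])
    show "Re (f x) \<le> \<epsilon> * norm x + (\<Sum>\<xi>\<leftarrow>D. norm (x *\<^sub>V \<xi>))" if "x \<in> M" for x
      using le[OF that] complex_Re_le_cmod order_trans by blast
  qed (use M f in \<open>auto simp: star_subalgebra_def scaleR_scaleC\<close>)
  then obtain L where L: "\<And>x. x \<in> M \<Longrightarrow> Re (f x) - Re (vector_sum L x) \<le> \<epsilon> * norm x" by blast
  have "cmod (f x - vector_sum L x) \<le> \<epsilon> * norm x" if x: "x \<in> M" for x
  proof (cases "f x = vector_sum L x")
    case True
    then show ?thesis using \<epsilon> by simp
  next
    case False
    \<comment> \<open>Rotate \<open>x\<close> by a phase that makes the difference positive.\<close>
    define z c where "z = f x - vector_sum L x" and "c = cnj z / of_real (cmod z)"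
    have z: "z \<noteq> 0" using False by (simp add: z_def)
    then have c: "cmod c = 1" by (simp add: c_def norm_divide)
    have "c * z = of_real (cmod z)"
      using z complex_norm_square[of z] by (simp add: c_def power2_eq_square field_simps)
    moreover have "f (c *\<^sub>C x) - vector_sum L (c *\<^sub>C x) = c * z"
      by (simp add: f x vector_sum_scaleC z_def algebra_simps)
    moreover have "c *\<^sub>C x \<in> M" using M x by (simp add: star_subalgebra_def)
    ultimately have "cmod z \<le> \<epsilon> * norm (c *\<^sub>C x)"
      using L[of "c *\<^sub>C x"] by (metis Re_complex_of_real minus_complex.sel(1))
    then show ?thesis by (simp add: z_def norm_scaleC c)
  qed
  then show ?thesis by blast
qed

text \<open>
  Vector functionals are considered on all bounded operators, because a real vector space is
  needed on which Hahn-Banach can be applied. Agreement on \<open>M\<close> is handled separately.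
\<close>

definition vector_functional ::
    "'h::complex_hilbert \<Rightarrow> 'h \<Rightarrow> (('h \<Rightarrow>\<^sub>C\<^sub>L 'h) \<Rightarrow>\<^sub>C\<^sub>L complex)"
  where "vector_functional \<xi> \<eta> = (SOME g. \<forall>x. g *\<^sub>V x = cinner (x *\<^sub>V \<xi>) \<eta>)"

lemma vector_functional_apply: "vector_functional \<xi> \<eta> *\<^sub>V x = cinner (x *\<^sub>V \<xi>) \<eta>"
proof -
  have "norm (cinner (x *\<^sub>V \<xi>) \<eta>) \<le> (norm \<xi> * norm \<eta>) * norm x" for x
    using cmod_vector_sum_le[of "[(\<xi>, \<eta>)]" x] by simp
  then obtain g :: "('a \<Rightarrow>\<^sub>C\<^sub>L 'a) \<Rightarrow>\<^sub>C\<^sub>L complex" where "\<And>x. g *\<^sub>V x = cinner (x *\<^sub>V \<xi>) \<eta>"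
    using cblinfun_of_map[of "\<lambda>x. cinner (x *\<^sub>V \<xi>) \<eta>" "norm \<xi> * norm \<eta>"]
    by (auto simp: cblinfun_simps cinner_simps scaleC_complex_def)
  then show ?thesis
    unfolding vector_functional_def using someI_ex[of "\<lambda>g. \<forall>x. g *\<^sub>V x = cinner (x *\<^sub>V \<xi>) \<eta>"] by blast
qed

text \<open>
  Let \<open>c\<close> be the infimal cost of all representations on \<open>M\<close>. Hahn-Banach gives a functional \<open>\<Lambda>\<close> on
  vector sums that is dominated by \<open>c\<close> and takes the value \<open>c g0\<close> at the given sum \<open>g0\<close>. On elementary
  tensors \<open>\<Lambda>\<close> is a bounded form, that is, a contraction \<open>T\<close>. Since \<open>\<Lambda>\<close> depends only on values on \<open>M\<close>,
  \<open>T\<close> commutes with the commutant, so \<open>T \<in> M\<close>. Hence the infimal cost is the value of \<open>g0\<close> at an element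
  of the unit ball of \<open>M\<close>.
\<close>

theorem economical_vector_sum:
  fixes M :: "('h::complex_hilbert \<Rightarrow>\<^sub>C\<^sub>L 'h) set"
  assumes M: "von_neumann_algebra M"
    and s: "0 \<le> s" "\<And>x. x \<in> M \<Longrightarrow> cmod (vector_sum L0 x) \<le> s * norm x" and "s < s'"
  obtains L where "\<And>x. x \<in> M \<Longrightarrow> vector_sum L x = vector_sum L0 x" "cost L < s'"
proof -
  define rep where "rep g L \<longleftrightarrow> (\<forall>x\<in>M. g *\<^sub>V x = vector_sum L x)"
    for g :: "('h \<Rightarrow>\<^sub>C\<^sub>L 'h) \<Rightarrow>\<^sub>C\<^sub>L complex" and L
  define V where "V = {g. \<exists>L. rep g L}"
  define c where "c g = (INF L\<in>{L. rep g L}. cost L)" for g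
  have rep_add: "rep (g + g') (L @ L')" if "rep g L" "rep g' L'" for g g' L L'
    using that by (simp add: rep_def cblinfun_simps)
  have rep_scale: "rep (r *\<^sub>R g) (scale_list r L)" if "rep g L" for g r L
    using that by (simp add: rep_def cblinfun_simps vector_sum_scale_list scaleR_conv_of_real)
  have rep_vector: "rep (vector_functional \<xi> \<eta>) [(\<xi>, \<eta>)]" for \<xi> \<eta>
    by (simp add: rep_def vector_functional_apply)
  have V_sub: "subspace V"
  proof (rule subspaceI)
    have "rep 0 []" by (simp add: rep_def cblinfun_simps)
    then show "0 \<in> V" by (auto simp: V_def)
  qed (use rep_add rep_scale in \<open>unfold V_def, blast+\<close>)
  have bdd: "bdd_below (cost ` {L. rep g L})" for g
    by (rule bdd_belowI2[of _ 0]) (simp add: cost_nonneg)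
  have c_le: "c g \<le> cost L" if "rep g L" for g L
    unfolding c_def using that by (intro cINF_lower[OF bdd]) simp
  have c_greatest: "k \<le> c g" if "g \<in> V" "\<And>L. rep g L \<Longrightarrow> k \<le> cost L" for g k
    unfolding c_def using that by (intro cINF_greatest) (auto simp: V_def)
  have c_add: "c (g + g') \<le> c g + c g'" if V: "g \<in> V" "g' \<in> V" for g g'
  proof -
    have "c (g + g') - cost L \<le> c g'" if "rep g L" for L
      using c_le[OF rep_add[OF that]] by (intro c_greatest[OF V(2)]) (simp add: algebra_simps)
    then have "c (g + g') - c g' \<le> c g"
      by (intro c_greatest[OF V(1)]) (simp add: algebra_simps)
    then show ?thesis by simp
  qed
  have c_scale: "c (t *\<^sub>R g) \<le> t * c g" if t: "t > 0" and V: "g \<in> V" for t g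
  proof -
    have "c (t *\<^sub>R g) / t \<le> c g"
    proof (rule c_greatest[OF V])
      fix L assume "rep g L"
      then show "c (t *\<^sub>R g) / t \<le> cost L"
        using c_le[OF rep_scale, of g L t] t by (simp add: cost_scale_list field_simps)
    qed
    then show ?thesis using t by (simp add: field_simps)
  qed
  have c_null: "c g \<le> 0" if "\<And>x. x \<in> M \<Longrightarrow> g *\<^sub>V x = 0" for g
    using c_le[of g "[]"] that by (simp add: rep_def)
  have V0: "0 \<in> V" using V_sub by (rule subspace_0)
  have c_zero: "c 0 = 0"
    using c_null[of 0] c_greatest[OF V0, of 0] by (simp add: cblinfun_simps cost_nonneg)
  \<comment> \<open>The seminorm \<open>c\<close> lives on \<open>V\<close> only; a linear projection extends it to all functionals.\<close>
  obtain P where P: "linear P" "range P \<subseteq> V" "\<And>g. g \<in> V \<Longrightarrow> P g = g"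
    using linear_exists_left_inverse_on[OF linear_id V_sub] by auto
  have sub: "sublinear (c \<circ> P)"
    using range_subsetD[OF P(2)] c_add c_scale c_zero
    by (auto simp: sublinear_def linear_add[OF P(1)] linear_scale[OF P(1)] linear_0[OF P(1)])
  define g0 where "g0 = (\<Sum>(\<xi>, \<eta>)\<leftarrow>L0. vector_functional \<xi> \<eta>)"
  have g0: "g0 *\<^sub>V x = vector_sum L0 x" for x
    unfolding g0_def by (induction L0) (auto simp: cblinfun_simps vector_functional_apply)
  have g0V: "g0 \<in> V" using g0 by (auto simp: V_def rep_def)
  have c_ge: "t * c g0 \<le> c (t *\<^sub>R g0)" if "t > 0" for t
    using c_scale[of "inverse t" "t *\<^sub>R g0"] that subspace_scale[OF V_sub g0V]
    by (simp add: field_simps)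
  obtain \<Lambda> where \<Lambda>: "linear \<Lambda>" "\<And>g. \<Lambda> g \<le> (c \<circ> P) g" "\<And>t. t \<in> {0..} \<Longrightarrow> t * c g0 \<le> \<Lambda> (t *\<^sub>R g0)"
  proof (rule mazur_orlicz[OF sub, of "{0::real..}" "\<lambda>t. t *\<^sub>R g0" "\<lambda>t. t * c g0"])
    show "t * c g0 \<le> (c \<circ> P) (t *\<^sub>R g0)" if "t \<in> {0..}" for t
      using that c_ge[of t] P(3)[OF subspace_scale[OF V_sub g0V], of t] c_zero
      by (cases "t = 0") (auto simp: linear_0[OF P(1)])
  qed (auto simp: algebra_simps)
  have \<Lambda>_le: "\<Lambda> g \<le> c g" if "g \<in> V" for g
    using \<Lambda>(2)[of g] P(3)[OF that] by simp
  have \<Lambda>_cong: "\<Lambda> g = \<Lambda> g'" if "g \<in> V" "g' \<in> V" "\<And>x. x \<in> M \<Longrightarrow> g *\<^sub>V x = g' *\<^sub>V x" for g g'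
  proof -
    have "\<Lambda> (g - g') \<le> 0" "\<Lambda> (g' - g) \<le> 0"
      using \<Lambda>_le c_null subspace_diff[OF V_sub] that
      by (metis cblinfun_diff_left diff_self order_trans)+
    then show ?thesis by (simp add: linear_diff[OF \<Lambda>(1)])
  qed
  have vV: "vector_functional \<xi> \<eta> \<in> V" for \<xi> \<eta>
    using rep_vector by (auto simp: V_def)
  define Y where "Y \<xi> \<eta> = \<Lambda> (vector_functional \<xi> \<eta>)" for \<xi> \<eta>
  have Y_le: "Y \<xi> \<eta> \<le> norm \<xi> * norm \<eta>" for \<xi> \<eta>
    using \<Lambda>_le[OF vV] c_le[OF rep_vector] order_trans unfolding Y_def by fastforce
  have vf_add_left: "vector_functional (\<xi> + \<xi>') \<eta> = vector_functional \<xi> \<eta> + vector_functional \<xi>' \<eta>"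
    and vf_add_right: "vector_functional \<xi> (\<eta> + \<eta>') = vector_functional \<xi> \<eta> + vector_functional \<xi> \<eta>'"
    and vf_scaleR: "vector_functional \<xi> (r *\<^sub>R \<eta>) = r *\<^sub>R vector_functional \<xi> \<eta>"
    and vf_balanced: "vector_functional (a *\<^sub>C \<xi>) \<eta> = vector_functional \<xi> (cnj a *\<^sub>C \<eta>)"
    for \<xi> \<xi>' \<eta> \<eta>' :: 'h and r a
    by (auto intro!: cblinfun_eqI simp: vector_functional_apply cblinfun_simps cinner_simps scaleR_conv_of_real)
  obtain T where T: "\<And>\<xi> \<eta>. Y \<xi> \<eta> = Re (cinner (T *\<^sub>V \<xi>) \<eta>)" "\<And>\<xi>. norm (T *\<^sub>V \<xi>) \<le> 1 * norm \<xi>"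
  proof (rule operator_of_form[of Y 1])
    show "\<bar>Y \<xi> \<eta>\<bar> \<le> 1 * norm \<xi> * norm \<eta>" for \<xi> \<eta>
      using Y_le[of \<xi> \<eta>] Y_le[of \<xi> "- \<eta>"] vf_scaleR[of \<xi> "- 1" \<eta>]
      by (simp add: Y_def linear_neg[OF \<Lambda>(1)])
  qed (simp_all add: Y_def vf_add_left vf_add_right vf_scaleR vf_balanced
      linear_add[OF \<Lambda>(1)] linear_scale[OF \<Lambda>(1)])
  \<comment> \<open>On \<open>M\<close>, an operator of the commutant may be moved from \<open>\<xi>\<close> to its adjoint on \<open>\<eta>\<close>.\<close>
  have "t o\<^sub>C\<^sub>L T = T o\<^sub>C\<^sub>L t" if t: "t \<in> commutant M" for t
  proof (rule cblinfun_eqI)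
    fix \<xi>
    obtain t' where t': "is_adjoint t t'" by (rule adjoint_exists)
    have "T *\<^sub>V (t *\<^sub>V \<xi>) = t *\<^sub>V (T *\<^sub>V \<xi>)"
    proof (rule Re_cinner_ext)
      fix \<eta>
      have "Y (t *\<^sub>V \<xi>) \<eta> = Y \<xi> (t' *\<^sub>V \<eta>)"
        unfolding Y_def using t' t
        by (intro \<Lambda>_cong vV) (simp add: vector_functional_apply commutant_commute[OF _ t] is_adjoint_def)
      then show "Re (cinner \<eta> (T *\<^sub>V (t *\<^sub>V \<xi>))) = Re (cinner \<eta> (t *\<^sub>V (T *\<^sub>V \<xi>)))"
        using t' by (simp add: T(1) is_adjoint_def Re_cinner_commute[of \<eta>])
    qed
    then show "(t o\<^sub>C\<^sub>L T) *\<^sub>V \<xi> = (T o\<^sub>C\<^sub>L t) *\<^sub>V \<xi>" by simp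
  qed
  then have "T \<in> commutant (commutant M)" by (auto simp: commutant_def)
  then have TM: "T \<in> M" using M by (simp add: von_neumann_algebra_def)
  have nT: "norm T \<le> 1" using T(2) by (intro norm_cblinfun_bound) auto
  have "\<Lambda> (\<Sum>(\<xi>, \<eta>)\<leftarrow>L. vector_functional \<xi> \<eta>) = Re (vector_sum L T)" for L
    by (induction L) (auto simp: linear_0[OF \<Lambda>(1)] linear_add[OF \<Lambda>(1)] Y_def[symmetric] T(1))
  then have "\<Lambda> g0 = Re (vector_sum L0 T)" by (simp add: g0_def)
  also have "\<dots> \<le> s * norm T" using s(2)[OF TM] complex_Re_le_cmod order_trans by blast
  also have "\<dots> \<le> s" using nT s(1) by (simp add: mult_left_le)
  finally have "c g0 < s'" using \<Lambda>(3)[of 1] \<open>s < s'\<close> by simp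
  then obtain L where "rep g0 L" "cost L < s'"
    unfolding c_def using g0V by (subst (asm) cINF_less_iff[OF _ bdd]) (auto simp: V_def)
  then show ?thesis using that g0 by (simp add: rep_def)
qed

section \<open>Norm limits of vector functionals are normal\<close>

lemma balanced_pair_exists:
  fixes \<xi> \<eta> :: "'h::complex_hilbert"
  shows "\<exists>\<xi>' \<eta>'. (norm \<xi>')\<^sup>2 = norm \<xi> * norm \<eta> \<and> (norm \<eta>')\<^sup>2 = norm \<xi> * norm \<eta> \<and>
    (\<forall>x. cinner (x *\<^sub>V \<xi>') \<eta>' = cinner (x *\<^sub>V \<xi>) \<eta>)"
proof (cases "\<xi> = 0 \<or> \<eta> = 0")
  case True
  then show ?thesis by (intro exI[of _ 0]) (auto simp: cblinfun_simps)
next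
  case False
  define r where "r = sqrt (norm \<eta> / norm \<xi>)"
  have r: "r > 0" "r\<^sup>2 = norm \<eta> / norm \<xi>" using False by (auto simp: r_def)
  have "(norm (r *\<^sub>R \<xi>))\<^sup>2 = norm \<xi> * norm \<eta>"
    unfolding norm_scaleR power_mult_distrib power2_abs r(2)
    using False by (simp add: power2_eq_square)
  moreover have "(norm (inverse r *\<^sub>R \<eta>))\<^sup>2 = norm \<xi> * norm \<eta>"
    unfolding norm_scaleR power_mult_distrib power2_abs power_inverse r(2)
    using False by (simp add: power2_eq_square)
  moreover have "cinner (x *\<^sub>V (r *\<^sub>R \<xi>)) (inverse r *\<^sub>R \<eta>) = cinner (x *\<^sub>V \<xi>) \<eta>" for x
    using r(1) by (simp add: cblinfun_simps cinner_simps)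
  ultimately show ?thesis by blast
qed

text \<open>
  Enumerate all pairs of all lists by \<open>prod_decode\<close>, padding rows with zeros, after rescaling each pair
  so that both vectors have the same norm: the products \<open>\<parallel>\<xi>\<parallel> \<parallel>\<eta>\<parallel>\<close> then become squares.
\<close>

lemma flatten_vector_sums:
  fixes c :: "nat \<Rightarrow> ('h::complex_hilbert \<times> 'h) list"
  assumes summ: "summable (\<lambda>k. cost (c k))"
  obtains \<xi> \<eta> :: "nat \<Rightarrow> 'h"
  where "summable (\<lambda>n. (norm (\<xi> n))\<^sup>2)" "summable (\<lambda>n. (norm (\<eta> n))\<^sup>2)"
    "\<And>x. (\<Sum>n. cinner (x *\<^sub>V \<xi> n) (\<eta> n)) = (\<Sum>k. vector_sum (c k) x)"
proof -
  have "\<exists>q :: 'h \<times> 'h. (norm (fst q))\<^sup>2 = norm (fst e) * norm (snd e) \<and>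
    (norm (snd q))\<^sup>2 = norm (fst e) * norm (snd e) \<and>
    (\<forall>x. cinner (x *\<^sub>V fst q) (snd q) = cinner (x *\<^sub>V fst e) (snd e))" for e :: "'h \<times> 'h"
    using balanced_pair_exists[of "fst e" "snd e"] by auto
  then obtain bal :: "'h \<times> 'h \<Rightarrow> 'h \<times> 'h" where
    bal1: "\<And>e. (norm (fst (bal e)))\<^sup>2 = norm (fst e) * norm (snd e)" and
    bal2: "\<And>e. (norm (snd (bal e)))\<^sup>2 = norm (fst e) * norm (snd e)" and
    bal3: "\<And>e x. cinner (x *\<^sub>V fst (bal e)) (snd (bal e)) = cinner (x *\<^sub>V fst e) (snd e)"
    by metis
  define e where "e kj = (if snd kj < length (c (fst kj)) then bal (c (fst kj) ! snd kj) else (0, 0))"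
    for kj
  define w where "w kj = (norm (fst (e kj)))\<^sup>2" for kj
  have w2: "(norm (snd (e kj)))\<^sup>2 = w kj" for kj
  proof (cases "snd kj < length (c (fst kj))")
    case True
    show ?thesis unfolding w_def e_def if_P[OF True] bal1 bal2 ..
  qed (simp add: w_def e_def)
  have w_row: "((\<lambda>j. w (k, j)) has_sum cost (c k)) UNIV" for k
  proof -
    have "cost (c k) = (\<Sum>j<length (c k). w (k, j))"
      by (simp add: cost_def sum_list_sum_nth atLeast0LessThan w_def e_def bal1 case_prod_beta)
    then have "((\<lambda>j. w (k, j)) has_sum cost (c k)) {..<length (c k)}"
      by (intro has_sum_finiteI) auto
    then show ?thesis
      by (subst has_sum_cong_neutral[where T = "{..<length (c k)}"]) (auto simp: w_def e_def)
  qed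
  have v_row: "((\<lambda>j. cinner (x *\<^sub>V fst (e (k, j))) (snd (e (k, j)))) has_sum vector_sum (c k) x) UNIV"
    for x k
  proof -
    have "vector_sum (c k) x = (\<Sum>j<length (c k). cinner (x *\<^sub>V fst (e (k, j))) (snd (e (k, j))))"
      by (simp add: vector_sum_def sum_list_sum_nth atLeast0LessThan e_def bal3 case_prod_beta)
    then have "((\<lambda>j. cinner (x *\<^sub>V fst (e (k, j))) (snd (e (k, j)))) has_sum vector_sum (c k) x)
        {..<length (c k)}"
      by (intro has_sum_finiteI) auto
    then show ?thesis
      by (subst has_sum_cong_neutral[where T = "{..<length (c k)}"]) (auto simp: e_def cblinfun_simps)
  qed
  have w_nonneg: "norm (w kj) = w kj" for kj by (simp add: w_def)
  have "(\<lambda>kj. norm (w kj)) summable_on Sigma UNIV (\<lambda>_. UNIV)"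
  proof (rule Infinite_Sum.abs_summable_on_Sigma_iff[THEN iffD2], intro conjI ballI)
    show "(\<lambda>j. norm (w (k, j))) summable_on UNIV" for k
      unfolding w_nonneg using w_row by (rule has_sum_imp_summable)
    have "(\<Sum>\<^sub>\<infinity>j. norm (w (k, j))) = cost (c k)" for k
      unfolding w_nonneg using w_row by (rule infsumI)
    then show "(\<lambda>k. norm (\<Sum>\<^sub>\<infinity>j. norm (w (k, j)))) summable_on UNIV"
      using summable_nonneg_imp_summable_on[OF summ] by (simp add: cost_nonneg)
  qed
  then have w_sum: "w summable_on UNIV" unfolding w_nonneg by simp
  have bij: "bij_betw prod_decode UNIV UNIV" by (rule bij_prod_decode)
  define \<xi> \<eta> where "\<xi> n = fst (e (prod_decode n))" and "\<eta> n = snd (e (prod_decode n))" for n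
  have w_seq: "summable (\<lambda>n. w (prod_decode n))"
    by (rule summable_on_imp_summable) (simp add: summable_on_reindex_bij_betw[OF bij] w_sum)
  show ?thesis
  proof
    show "summable (\<lambda>n. (norm (\<xi> n))\<^sup>2)" "summable (\<lambda>n. (norm (\<eta> n))\<^sup>2)"
      using w_seq by (simp_all add: \<xi>_def \<eta>_def w_def[symmetric] w2)
    fix x :: "'h \<Rightarrow>\<^sub>C\<^sub>L 'h"
    let ?v = "\<lambda>kj. cinner (x *\<^sub>V fst (e kj)) (snd (e kj))"
    have "norm (?v kj) \<le> norm x * w kj" for kj
    proof -
      have eq: "norm (fst (e kj)) = norm (snd (e kj))"
        using w2[of kj] unfolding w_def by (metis norm_ge_zero power2_eq_iff_nonneg)
      have "norm (?v kj) \<le> norm (x *\<^sub>V fst (e kj)) * norm (snd (e kj))"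
        by (rule cinner_cauchy_schwarz)
      also have "\<dots> \<le> norm x * norm (fst (e kj)) * norm (snd (e kj))"
        by (intro mult_right_mono norm_cblinfun) simp
      finally show ?thesis by (simp add: w_def eq power2_eq_square)
    qed
    moreover have "(\<lambda>kj. norm x * w kj) summable_on UNIV"
      by (rule summable_on_cmult_right[OF w_sum])
    ultimately have v_abs: "(\<lambda>kj. norm (?v kj)) summable_on UNIV"
      by (rule Infinite_Sum.abs_summable_on_comparison_test'[rotated])
    then have v_sum: "?v summable_on UNIV" by (rule Infinite_Sum.abs_summable_summable)
    have "(\<lambda>n. ?v (prod_decode n)) summable_on UNIV"
      by (simp add: summable_on_reindex_bij_betw[OF bij, of ?v] v_sum)
    then have "(\<lambda>n. ?v (prod_decode n)) sums (\<Sum>\<^sub>\<infinity>n. ?v (prod_decode n))"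
      by (intro has_sum_imp_sums has_sum_infsum)
    moreover have "(\<Sum>\<^sub>\<infinity>n. ?v (prod_decode n)) = infsum ?v UNIV"
      by (rule infsum_reindex_bij_betw[OF bij])
    moreover have "infsum ?v UNIV = (\<Sum>\<^sub>\<infinity>k. \<Sum>\<^sub>\<infinity>j. ?v (k, j))"
      using infsum_Sigma_banach[of ?v UNIV "\<lambda>_. UNIV"] v_sum by simp
    moreover have "(\<Sum>\<^sub>\<infinity>j. ?v (k, j)) = vector_sum (c k) x" for k
      using v_row by (rule infsumI)
    moreover have "(\<lambda>k. vector_sum (c k) x) sums (\<Sum>\<^sub>\<infinity>k. vector_sum (c k) x)"
    proof (intro has_sum_imp_sums has_sum_infsum norm_summable_imp_summable_on)
      show "summable (\<lambda>k. norm (vector_sum (c k) x))"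
        by (rule summable_comparison_test'[OF summable_mult2[OF summ, of "norm x"]])
          (simp add: cmod_vector_sum_le)
    qed
    ultimately show "(\<Sum>n. cinner (x *\<^sub>V \<xi> n) (\<eta> n)) = (\<Sum>k. vector_sum (c k) x)"
      by (simp add: \<xi>_def \<eta>_def sums_iff)
  qed
qed

text \<open>
  The differences of an approximating sequence with errors \<open>2\<^sup>-\<^sup>n\<close> have norms of the same order on \<open>M\<close>.
  Rewritten economically they have summable costs, so their representations can be joined.
\<close>

theorem vn_predualI:
  fixes M :: "('h::complex_hilbert \<Rightarrow>\<^sub>C\<^sub>L 'h) set"
  assumes M: "von_neumann_algebra M"
    and approx: "\<And>\<epsilon>. \<epsilon> > 0 \<Longrightarrow> \<exists>L. \<forall>x\<in>M. cmod (f x - vector_sum L x) \<le> \<epsilon> * norm x"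
  shows "f \<in> vn_predual M"
proof -
  have "\<exists>L. \<forall>x\<in>M. cmod (f x - vector_sum L x) \<le> (1/2) ^ n * norm x" for n
    by (rule approx) simp
  then obtain h where h: "\<And>n x. x \<in> M \<Longrightarrow> cmod (f x - vector_sum (h n) x) \<le> (1/2) ^ n * norm x"
    by metis
  have "\<exists>g. (\<forall>x\<in>M. vector_sum g x = vector_sum (h (Suc n)) x - vector_sum (h n) x) \<and>
    cost g < 3 * (1/2) ^ n" for n
  proof -
    define d where "d = h (Suc n) @ scale_list (- 1) (h n)"
    have d: "vector_sum d x = vector_sum (h (Suc n)) x - vector_sum (h n) x" for x
      by (simp add: d_def vector_sum_scale_list)
    have "cmod (vector_sum d x) \<le> 2 * (1/2) ^ n * norm x" if "x \<in> M" for x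
    proof -
      have "vector_sum d x = (f x - vector_sum (h n) x) - (f x - vector_sum (h (Suc n)) x)"
        by (simp add: d)
      also have "cmod \<dots> \<le> (1/2) ^ n * norm x + (1/2) ^ Suc n * norm x"
        by (rule order_trans[OF norm_triangle_ineq4 add_mono[OF h[OF that] h[OF that]]])
      also have "\<dots> \<le> 2 * (1/2) ^ n * norm x"
        by simp
      finally show ?thesis .
    qed
    then obtain g where "\<And>x. x \<in> M \<Longrightarrow> vector_sum g x = vector_sum d x" "cost g < 3 * (1/2) ^ n"
      using economical_vector_sum[OF M, of "2 * (1/2) ^ n" d "3 * (1/2) ^ n"] by auto
    then show ?thesis using d by auto
  qed
  then obtain g where g: "\<And>n x. x \<in> M \<Longrightarrow> vector_sum (g n) x = vector_sum (h (Suc n)) x - vector_sum (h n) x"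
    and cost_g: "\<And>n. cost (g n) < 3 * (1/2) ^ n"
    by metis
  define c where "c k = (case k of 0 \<Rightarrow> h 0 | Suc n \<Rightarrow> g n)" for k
  have "summable (\<lambda>n. cost (g n))"
  proof (rule summable_comparison_test')
    show "summable (\<lambda>n. 3 * (1/2) ^ n :: real)" by (intro summable_mult summable_geometric) simp
    show "norm (cost (g n)) \<le> 3 * (1/2) ^ n" for n
      using cost_g[of n] by (simp add: cost_nonneg)
  qed
  then have "summable (\<lambda>k. cost (c k))"
    by (subst summable_Suc_iff[symmetric]) (simp add: c_def)
  then obtain \<xi> \<eta> where seq: "summable (\<lambda>n. (norm (\<xi> n))\<^sup>2)" "summable (\<lambda>n. (norm (\<eta> n))\<^sup>2)"
    "\<And>x. (\<Sum>n. cinner (x *\<^sub>V \<xi> n) (\<eta> n)) = (\<Sum>k. vector_sum (c k) x)"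
    using flatten_vector_sums by blast
  have "f x = (\<Sum>n. cinner (x *\<^sub>V \<xi> n) (\<eta> n))" if x: "x \<in> M" for x
  proof -
    have partial: "(\<Sum>k<Suc n. vector_sum (c k) x) = vector_sum (h n) x" for n
      by (induction n) (simp_all add: c_def g[OF x])
    have "(\<lambda>n. vector_sum (h n) x) \<longlonglongrightarrow> f x"
    proof (rule LIM_zero_cancel, rule Lim_null_comparison)
      show "\<forall>\<^sub>F n in sequentially. norm (vector_sum (h n) x - f x) \<le> (1/2) ^ n * norm x"
        using h[OF x] by (simp add: norm_minus_commute)
      show "(\<lambda>n. (1/2) ^ n * norm x) \<longlonglongrightarrow> 0"
        by (intro tendsto_mult_left_zero LIMSEQ_power_zero) simp
    qed
    then have "(\<lambda>n. \<Sum>k<Suc n. vector_sum (c k) x) \<longlonglongrightarrow> f x" by (simp only: partial)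
    then have "(\<lambda>k. vector_sum (c k) x) sums f x"
      unfolding sums_def by (rule LIMSEQ_imp_Suc)
    then show ?thesis by (simp add: seq(3) sums_iff)
  qed
  then show ?thesis using seq(1,2) by (auto simp: vn_predual_def)
qed

section \<open>Cluster points in weak topologies\<close>

lemma limitin_weak_topology_UNIV:
  "limitin (weak_topology UNIV Fs) y l G \<longleftrightarrow> (\<forall>f\<in>Fs. ((\<lambda>i. f (y i)) \<longlongrightarrow> f l) G)"
proof (intro iffI ballI)
  fix f assume lim: "limitin (weak_topology UNIV Fs) y l G" and f: "f \<in> Fs"
  show "((\<lambda>i. f (y i)) \<longlongrightarrow> f l) G"
  proof (rule topological_tendstoI)
    fix U :: "complex set" assume U: "open U" "f l \<in> U"
    have "openin (weak_topology UNIV Fs) (f -` U)"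
      unfolding weak_topology_def using f U(1) by (intro topology_generated_by_Basis) auto
    then show "\<forall>\<^sub>F i in G. f (y i) \<in> U"
      using lim U(2) by (auto simp: limitin_def)
  qed
next
  assume lim: "\<forall>f\<in>Fs. ((\<lambda>i. f (y i)) \<longlongrightarrow> f l) G"
  have "l \<in> U \<longrightarrow> (\<forall>\<^sub>F i in G. y i \<in> U)"
    if "generate_topology_on (insert UNIV {f -` U \<inter> UNIV |f U. f \<in> Fs \<and> open U}) U" for U
    using that
  proof induction
    case (Int a b)
    then show ?case by (auto intro: eventually_conj)
  next
    case (UN K)
    show ?case
    proof
      assume "l \<in> \<Union>K"
      then obtain k where k: "k \<in> K" "l \<in> k" by blast
      then have "\<forall>\<^sub>F i in G. y i \<in> k" using UN by blast
      then show "\<forall>\<^sub>F i in G. y i \<in> \<Union>K" by (rule eventually_mono) (use k in blast)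
    qed
  next
    case (Basis s)
    then show ?case
    proof (cases "s = UNIV")
      case False
      with Basis obtain f V where fV: "s = f -` V" "f \<in> Fs" "open V" by auto
      show ?thesis
        using topological_tendstoD[OF lim[rule_format, OF fV(2)] fV(3)] fV(1) by auto
    qed simp
  qed simp
  then show "limitin (weak_topology UNIV Fs) y l G"
    unfolding limitin_def weak_topology_def
    by (auto dest: openin_topology_generated_by simp: topology_generated_by_topspace)
qed

text \<open>
  Tychonoff's theorem for a product of discs, phrased with a finer filter in place of a subnet.
\<close>

lemma pointwise_bounded_cluster:
  fixes g :: "'i \<Rightarrow> 'p \<Rightarrow> complex"
  assumes F: "F \<noteq> bot" and bound: "\<And>i p. cmod (g i p) \<le> r p"
  obtains G \<Lambda> where "G \<le> F" "G \<noteq> bot" "\<And>p. ((\<lambda>i. g i p) \<longlongrightarrow> \<Lambda> p) G" "\<And>p. cmod (\<Lambda> p) \<le> r p"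
proof -
  define S where "S = PiE UNIV (\<lambda>p. cball (0::complex) (r p))"
  have "compactin (product_topology (\<lambda>_. euclidean) UNIV) S"
    unfolding S_def compactin_PiE by (auto intro: compact_cball)
  then have S: "compact S" by (simp add: euclidean_product_topology)
  have "filtermap g F \<noteq> bot" using F by (simp add: filtermap_bot_iff)
  moreover have "\<forall>\<^sub>F h in filtermap g F. h \<in> S"
    using bound by (simp add: eventually_filtermap S_def PiE_iff)
  ultimately obtain \<Lambda> where \<Lambda>: "\<Lambda> \<in> S" "inf (nhds \<Lambda>) (filtermap g F) \<noteq> bot"
    using S unfolding compact_filter by blast
  define G where "G = inf F (filtercomap g (nhds \<Lambda>))"
  have "G \<noteq> bot"
  proof
    assume "G = bot"
    then obtain P Q where P: "eventually P F" and Q: "eventually Q (filtercomap g (nhds \<Lambda>))"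
      and PQ: "\<And>i. P i \<Longrightarrow> Q i \<Longrightarrow> False"
      unfolding G_def trivial_limit_def eventually_inf by blast
    obtain R where R: "eventually R (nhds \<Lambda>)" "\<And>i. R (g i) \<Longrightarrow> Q i"
      using Q unfolding eventually_filtercomap by blast
    have "eventually (\<lambda>h. \<not> R h) (filtermap g F)"
      unfolding eventually_filtermap using P by (rule eventually_mono) (use PQ R(2) in blast)
    then have "eventually (\<lambda>_. False) (inf (nhds \<Lambda>) (filtermap g F))"
      unfolding eventually_inf using R(1) by blast
    then show False using \<Lambda>(2) by (simp add: trivial_limit_def)
  qed
  have "filterlim g (nhds \<Lambda>) G"
    unfolding G_def filterlim_def by (metis filtermap_filtercomap filtermap_mono inf.cobounded2 order_trans)
  then have "((\<lambda>i. g i p) \<longlongrightarrow> \<Lambda> p) G" for p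
    using continuous_on_tendsto_compose[OF continuous_on_product_coordinates[of p]] by auto
  moreover have "G \<le> F" by (simp add: G_def)
  moreover have "cmod (\<Lambda> p) \<le> r p" for p
    using \<Lambda>(1) by (auto simp: S_def PiE_iff)
  ultimately show ?thesis using \<open>G \<noteq> bot\<close> that by blast
qed

section \<open>A von Neumann algebra isomorphic to a dual Banach algebra\<close>

locale dual_isomorphism =
  fixes M :: "('h::complex_hilbert \<Rightarrow>\<^sub>C\<^sub>L 'h) set"
    and \<Phi> :: "'b::complex_banach_algebra \<Rightarrow> ('p::complex_banach \<Rightarrow>\<^sub>C\<^sub>L complex)"
    and \<theta> :: "('h \<Rightarrow>\<^sub>C\<^sub>L 'h) \<Rightarrow> 'b"
  assumes von_neumann: "von_neumann_algebra M"
    and dual: "dual_banach_algebra \<Phi>"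
    and isomorphism: "banach_algebra_isomorphism M \<theta>"
begin

lemma star_M: "star_subalgebra M"
  using von_neumann by (simp add: von_neumann_algebra_def)

lemma
  shows zero_M: "0 \<in> M"
    and add_M: "x \<in> M \<Longrightarrow> y \<in> M \<Longrightarrow> x + y \<in> M"
    and scaleC_M: "x \<in> M \<Longrightarrow> a *\<^sub>C x \<in> M"
    and scaleR_M: "x \<in> M \<Longrightarrow> r *\<^sub>R x \<in> M"
    and compose_M: "x \<in> M \<Longrightarrow> y \<in> M \<Longrightarrow> x o\<^sub>C\<^sub>L y \<in> M"
    and adjoint_M: "x \<in> M \<Longrightarrow> \<exists>y\<in>M. is_adjoint x y"
  using star_M by (auto simp: star_subalgebra_def scaleR_scaleC)

lemma sum_M: "(\<And>k. k \<in> A \<Longrightarrow> v k \<in> M) \<Longrightarrow> sum v A \<in> M"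
  by (induction A rule: infinite_finite_induct) (auto simp: zero_M add_M)

lemma
  shows theta_add: "x \<in> M \<Longrightarrow> y \<in> M \<Longrightarrow> \<theta> (x + y) = \<theta> x + \<theta> y"
    and theta_scaleC: "x \<in> M \<Longrightarrow> \<theta> (a *\<^sub>C x) = a *\<^sub>C \<theta> x"
    and theta_compose: "x \<in> M \<Longrightarrow> y \<in> M \<Longrightarrow> \<theta> (x o\<^sub>C\<^sub>L y) = \<theta> x * \<theta> y"
    and theta_bij: "bij_betw \<theta> M UNIV"
  using isomorphism by (auto simp: banach_algebra_isomorphism_def)

lemma theta_bounded: obtains K where "K \<ge> 0" "\<And>x. x \<in> M \<Longrightarrow> norm (\<theta> x) \<le> K * norm x"
proof -
  obtain K where K: "\<And>x. x \<in> M \<Longrightarrow> norm (\<theta> x) \<le> K * norm x"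
    using isomorphism unfolding banach_algebra_isomorphism_def by blast
  have "norm (\<theta> x) \<le> \<bar>K\<bar> * norm x" if "x \<in> M" for x
    using K[OF that] by (meson abs_ge_self mult_right_mono norm_ge_zero order_trans)
  then show ?thesis using that[of "\<bar>K\<bar>"] by simp
qed

text \<open>
  If \<open>\<mu> = \<parallel>x\<parallel>\<^sup>2\<close> exceeded \<open>\<parallel>\<theta> a\<parallel>\<close> for \<open>a = x\<^sup>* x\<close>, then \<open>\<mu> - \<theta> a\<close> would be invertible in the sense of
  quasi-inverses, and so would \<open>\<mu> - a\<close>. This is impossible, because vectors on which \<open>x\<close> almost attains
  its norm are approximate eigenvectors of \<open>a\<close> for the eigenvalue \<open>\<mu>\<close>.
\<close>

lemma norm_square_le_theta:
  assumes x: "x \<in> M" and y: "y \<in> M" "is_adjoint x y"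
  shows "(norm x)\<^sup>2 \<le> norm (\<theta> (y o\<^sub>C\<^sub>L x))"
proof (rule ccontr)
  define a where "a = y o\<^sub>C\<^sub>L x"
  define \<mu> where "\<mu> = (norm x)\<^sup>2"
  assume "\<not> ?thesis"
  then have less: "norm (\<theta> a) < \<mu>" by (simp add: a_def \<mu>_def)
  then have \<mu>: "\<mu> > 0" using norm_ge_zero[of "\<theta> a"] by linarith
  have aM: "a \<in> M" using x y by (simp add: a_def compose_M)
  \<comment> \<open>A quasi-inverse of \<open>\<theta> a / \<mu>\<close> exists in the Banach algebra, hence in \<open>M\<close>.\<close>
  have "\<exists>!c. (1 / \<mu>) *\<^sub>R (\<theta> a + c * \<theta> a) = c"
  proof (rule banach_fix_type[of "norm (\<theta> a) / \<mu>"])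
    show "\<forall>c d. dist ((1 / \<mu>) *\<^sub>R (\<theta> a + c * \<theta> a)) ((1 / \<mu>) *\<^sub>R (\<theta> a + d * \<theta> a))
        \<le> norm (\<theta> a) / \<mu> * dist c d"
    proof (intro allI)
      fix c d
      have "dist ((1 / \<mu>) *\<^sub>R (\<theta> a + c * \<theta> a)) ((1 / \<mu>) *\<^sub>R (\<theta> a + d * \<theta> a))
          = norm ((1 / \<mu>) *\<^sub>R ((c - d) * \<theta> a))"
        by (simp add: dist_norm algebra_simps)
      also have "\<dots> \<le> norm (\<theta> a) / \<mu> * dist c d"
        using norm_mult_ineq[of "c - d" "\<theta> a"] \<mu> by (simp add: dist_norm divide_simps ac_simps)
      finally show "dist ((1 / \<mu>) *\<^sub>R (\<theta> a + c * \<theta> a)) ((1 / \<mu>) *\<^sub>R (\<theta> a + d * \<theta> a))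
        \<le> norm (\<theta> a) / \<mu> * dist c d" .
    qed
  qed (use less \<mu> in auto)
  then obtain c where c: "(1 / \<mu>) *\<^sub>R (\<theta> a + c * \<theta> a) = c" by blast
  then have "\<theta> a + c * \<theta> a = \<mu> *\<^sub>R c"
    using \<mu> by (metis divide_self_if less_irrefl scaleR_one scaleR_scaleR times_divide_eq_right mult.right_neutral)
  moreover obtain b where b: "b \<in> M" "\<theta> b = c"
    using theta_bij by (metis UNIV_I bij_betw_imp_surj_on imageE)
  ultimately have "\<theta> (a + b o\<^sub>C\<^sub>L a) = \<theta> (\<mu> *\<^sub>R b)"
    using aM b by (simp add: theta_add compose_M theta_compose scaleR_scaleC theta_scaleC)
  then have ab: "a + b o\<^sub>C\<^sub>L a = \<mu> *\<^sub>R b"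
    using theta_bij aM b by (auto simp: bij_betw_def inj_on_def add_M compose_M scaleR_M)
  define C where "C = 1 + norm b"
  have C: "C > 0" by (simp add: C_def add_pos_nonneg)
  have "norm (x *\<^sub>V h) \<le> sqrt (\<mu> - \<mu> / (2 * C\<^sup>2)) * norm h" for h
  proof -
    have na: "norm (a *\<^sub>V h) \<le> \<mu> * norm h"
    proof -
      have "norm (a *\<^sub>V h) \<le> norm y * norm (x *\<^sub>V h)"
        by (simp add: a_def norm_cblinfun)
      also have "\<dots> \<le> norm x * (norm x * norm h)"
        using norm_adjoint_le[OF y(2)] by (intro mult_mono norm_cblinfun) auto
      finally show ?thesis by (simp add: \<mu>_def power2_eq_square)
    qed
    define d where "d = \<mu> *\<^sub>R h - a *\<^sub>V h"
    have "a *\<^sub>V h = b *\<^sub>V d"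
      using arg_cong[OF ab, of "\<lambda>t. t *\<^sub>V h"] by (simp add: d_def cblinfun_simps algebra_simps)
    then have "norm (a *\<^sub>V h) \<le> norm b * norm d" by (simp add: norm_cblinfun)
    then have "\<mu> * norm h \<le> C * norm d"
      using norm_triangle_ineq[of d "a *\<^sub>V h"] \<mu> by (simp add: d_def C_def algebra_simps)
    then have "(\<mu> * norm h)\<^sup>2 \<le> (C * norm d)\<^sup>2"
      using \<mu> by (intro power_mono) auto
    moreover have "(norm d)\<^sup>2 \<le> 2 * \<mu> * (\<mu> * (norm h)\<^sup>2 - (norm (x *\<^sub>V h))\<^sup>2)"
    proof -
      have "Re (cinner h (a *\<^sub>V h)) = (norm (x *\<^sub>V h))\<^sup>2"
        using y(2) by (simp add: a_def is_adjoint_def[of x y] Re_cinner_self[symmetric])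
      then have "(norm d)\<^sup>2 = \<mu>\<^sup>2 * (norm h)\<^sup>2 - 2 * \<mu> * (norm (x *\<^sub>V h))\<^sup>2 + (norm (a *\<^sub>V h))\<^sup>2"
        using norm_add_square[of "\<mu> *\<^sub>R h" "- (a *\<^sub>V h)"]
        by (simp add: d_def cinner_simps power_mult_distrib)
      moreover have "(norm (a *\<^sub>V h))\<^sup>2 \<le> (\<mu> * norm h)\<^sup>2"
        using na by (intro power_mono) auto
      ultimately show ?thesis by (simp add: power_mult_distrib power2_eq_square algebra_simps)
    qed
    ultimately have "\<mu>\<^sup>2 * (norm h)\<^sup>2 \<le> C\<^sup>2 * (2 * \<mu> * (\<mu> * (norm h)\<^sup>2 - (norm (x *\<^sub>V h))\<^sup>2))"
      unfolding power_mult_distrib by (meson mult_left_mono order_trans zero_le_power2)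
    then have "\<mu> * (\<mu> * (norm h)\<^sup>2) \<le> \<mu> * (2 * C\<^sup>2 * (\<mu> * (norm h)\<^sup>2 - (norm (x *\<^sub>V h))\<^sup>2))"
      by (simp add: power2_eq_square algebra_simps)
    then have "\<mu> * (norm h)\<^sup>2 \<le> 2 * C\<^sup>2 * (\<mu> * (norm h)\<^sup>2 - (norm (x *\<^sub>V h))\<^sup>2)"
      using \<mu> by simp
    then have "(norm (x *\<^sub>V h))\<^sup>2 \<le> (\<mu> - \<mu> / (2 * C\<^sup>2)) * (norm h)\<^sup>2"
      using C by (simp add: field_simps)
    then have "sqrt ((norm (x *\<^sub>V h))\<^sup>2) \<le> sqrt ((\<mu> - \<mu> / (2 * C\<^sup>2)) * (norm h)\<^sup>2)"
      by (rule real_sqrt_le_mono)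
    then show ?thesis by (simp add: real_sqrt_mult)
  qed
  moreover have "\<mu> - \<mu> / (2 * C\<^sup>2) \<ge> 0"
  proof -
    have "1 \<le> C\<^sup>2" unfolding C_def by (rule one_le_power) simp
    then have "\<mu> / (2 * C\<^sup>2) \<le> \<mu> / 1" using \<mu> by (intro divide_left_mono) auto
    then show ?thesis by simp
  qed
  ultimately have "norm x \<le> sqrt (\<mu> - \<mu> / (2 * C\<^sup>2))"
    by (intro norm_cblinfun_bound) auto
  then have "(norm x)\<^sup>2 \<le> (sqrt (\<mu> - \<mu> / (2 * C\<^sup>2)))\<^sup>2"
    by (intro power_mono) auto
  then have "\<mu> \<le> \<mu> - \<mu> / (2 * C\<^sup>2)"
    using \<open>\<mu> - \<mu> / (2 * C\<^sup>2) \<ge> 0\<close> by (simp add: \<mu>_def)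
  moreover have "\<mu> / (2 * C\<^sup>2) > 0" using \<mu> C by simp
  ultimately show False by linarith
qed

text \<open>
  \<open>\<parallel>x\<parallel>\<^sup>2 \<le> \<parallel>\<theta> (x\<^sup>* x)\<parallel> \<le> \<parallel>\<theta> (x\<^sup>*)\<parallel> \<parallel>\<theta> x\<parallel>\<close>, and the first factor is at most a multiple of \<open>\<parallel>x\<parallel>\<close>.
\<close>

lemma theta_bounded_below:
  obtains K where "K \<ge> 0" "\<And>x. x \<in> M \<Longrightarrow> norm x \<le> K * norm (\<theta> x)"
proof -
  obtain K where K: "K \<ge> 0" "\<And>x. x \<in> M \<Longrightarrow> norm (\<theta> x) \<le> K * norm x" by (rule theta_bounded) blast
  have "norm x \<le> K * norm (\<theta> x)" if x: "x \<in> M" for x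
  proof -
    obtain y where y: "y \<in> M" "is_adjoint x y" using adjoint_M[OF x] by blast
    have "norm x * norm x \<le> norm (\<theta> (y o\<^sub>C\<^sub>L x))"
      using norm_square_le_theta[OF x y] by (simp add: power2_eq_square)
    also have "\<dots> \<le> norm (\<theta> y) * norm (\<theta> x)"
      using norm_mult_ineq x y(1) by (simp add: theta_compose)
    also have "\<dots> \<le> K * norm x * norm (\<theta> x)"
      using K(2)[OF y(1)] mult_left_mono[OF norm_adjoint_le[OF y(2)] K(1)]
      by (intro mult_right_mono) auto
    finally show ?thesis using K(1) by (cases "x = 0") (auto simp: algebra_simps)
  qed
  then show ?thesis using K(1) that by blast
qed

definition functional :: "'p \<Rightarrow> ('h \<Rightarrow>\<^sub>C\<^sub>L 'h) \<Rightarrow> complex"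
  where "functional p x = \<Phi> (\<theta> x) *\<^sub>V p"

lemma
  shows Phi_bij: "bij \<Phi>" and Phi_linear: "bounded_linear \<Phi>" and inv_Phi_linear: "bounded_linear (inv \<Phi>)"
    and Phi_scaleC: "\<Phi> (a *\<^sub>C b) = a *\<^sub>C \<Phi> b"
    and right_mult_continuous:
      "continuous_map (weak_star_topology \<Phi>) (weak_star_topology \<Phi>) (\<lambda>c. c * b)"
  using dual by (auto simp: dual_banach_algebra_def bounded_clinear_def)

lemma functional_add: "x \<in> M \<Longrightarrow> y \<in> M \<Longrightarrow> functional p (x + y) = functional p x + functional p y"
  by (simp add: functional_def theta_add linear_add[OF bounded_linear.linear[OF Phi_linear]] cblinfun_simps)

lemma functional_scaleC: "x \<in> M \<Longrightarrow> functional p (a *\<^sub>C x) = a * functional p x"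
  by (simp add: functional_def theta_scaleC Phi_scaleC cblinfun_simps scaleC_complex_def)

lemma functional_scaleR: "x \<in> M \<Longrightarrow> functional p (r *\<^sub>R x) = of_real r * functional p x"
  by (simp add: scaleR_scaleC functional_scaleC)

lemma functional_zero: "functional p 0 = 0"
  using functional_scaleR[OF zero_M, of p 0] by simp

lemma functional_sum: "(\<And>k. k \<in> A \<Longrightarrow> v k \<in> M) \<Longrightarrow> functional p (sum v A) = (\<Sum>k\<in>A. functional p (v k))"
  by (induction A rule: infinite_finite_induct) (auto simp: functional_zero functional_add sum_M)

lemma functional_bounded:
  obtains K where "K \<ge> 0" "\<And>x p. x \<in> M \<Longrightarrow> cmod (functional p x) \<le> K * norm x * norm p"
proof -
  obtain K where K: "K \<ge> 0" "\<And>x. x \<in> M \<Longrightarrow> norm (\<theta> x) \<le> K * norm x" by (rule theta_bounded) blast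
  obtain N where N: "N > 0" "\<And>b. norm (\<Phi> b) \<le> norm b * N"
    using bounded_linear.pos_bounded[OF Phi_linear] by blast
  have "cmod (functional p x) \<le> (N * K) * norm x * norm p" if x: "x \<in> M" for x p
  proof -
    have "cmod (functional p x) \<le> norm (\<Phi> (\<theta> x)) * norm p"
      by (simp add: functional_def norm_cblinfun)
    also have "\<dots> \<le> (norm (\<theta> x) * N) * norm p" by (intro mult_right_mono N(2)) simp
    also have "\<dots> \<le> ((K * norm x) * N) * norm p" using N(1) K(2)[OF x] by (intro mult_right_mono) auto
    finally show ?thesis by (simp add: ac_simps)
  qed
  then show ?thesis using that[of "N * K"] N K by simp
qed

lemma functional_bounds_norm:
  obtains K where "K \<ge> 0"
    "\<And>x s. x \<in> M \<Longrightarrow> s \<ge> 0 \<Longrightarrow> (\<And>p. cmod (functional p x) \<le> s * norm p) \<Longrightarrow> norm x \<le> K * s"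
proof -
  obtain K where K: "K \<ge> 0" "\<And>x. x \<in> M \<Longrightarrow> norm x \<le> K * norm (\<theta> x)" by (rule theta_bounded_below) blast
  obtain N where N: "N > 0" "\<And>f. norm (inv \<Phi> f) \<le> norm f * N"
    using bounded_linear.pos_bounded[OF inv_Phi_linear] by blast
  have "norm x \<le> (K * N) * s" if "x \<in> M" "s \<ge> 0" "\<And>p. cmod (functional p x) \<le> s * norm p" for x s
  proof -
    have "norm (\<Phi> (\<theta> x)) \<le> s"
      using that by (intro norm_cblinfun_bound) (auto simp: functional_def)
    then have "norm (\<theta> x) \<le> s * N"
      using N(2)[of "\<Phi> (\<theta> x)"] N(1) Phi_bij
      by (simp add: bij_is_inj) (meson mult_right_mono less_imp_le order_trans)
    then show ?thesis using K(2)[OF that(1)] K(1) mult_left_mono[of "norm (\<theta> x)" "s * N" K]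
      by (simp add: ac_simps)
  qed
  then show ?thesis using that[of "K * N"] K N by simp
qed

lemma functional_separates:
  assumes "x \<in> M" "y \<in> M" "\<And>p. functional p x = functional p y"
  shows "x = y"
proof -
  have "\<Phi> (\<theta> x) = \<Phi> (\<theta> y)"
    using assms(3) by (intro cblinfun_eqI) (simp add: functional_def)
  then have "\<theta> x = \<theta> y" using Phi_bij by (meson bij_is_inj injD)
  then show ?thesis using theta_bij assms(1,2) by (auto simp: bij_betw_def inj_on_def)
qed

text \<open>
  A cluster point of the functionals \<open>p \<mapsto> functional p (x i)\<close> is again linear and bounded, so it comes
  from an element of the dual Banach algebra and thus from \<open>M\<close>.
\<close>

theorem bounded_cluster:
  fixes x :: "'i \<Rightarrow> ('h \<Rightarrow>\<^sub>C\<^sub>L 'h)"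
  assumes F: "F \<noteq> bot" and x: "\<And>i. x i \<in> M" "\<And>i. norm (x i) \<le> r"
  obtains G z where "G \<le> F" "G \<noteq> bot" "z \<in> M" "\<And>p. ((\<lambda>i. functional p (x i)) \<longlongrightarrow> functional p z) G"
proof -
  obtain K where K: "K \<ge> 0" "\<And>x p. x \<in> M \<Longrightarrow> cmod (functional p x) \<le> K * norm x * norm p"
    by (rule functional_bounded) blast
  have bound: "cmod (functional p (x i)) \<le> K * r * norm p" for i p
    using K(2)[OF x(1)] mult_right_mono[OF mult_left_mono[OF x(2) K(1)] norm_ge_zero] order_trans by blast
  obtain G \<Lambda> where G: "G \<le> F" "G \<noteq> bot" "\<And>p. ((\<lambda>i. functional p (x i)) \<longlongrightarrow> \<Lambda> p) G"
    and \<Lambda>: "\<And>p. cmod (\<Lambda> p) \<le> K * r * norm p"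
    using pointwise_bounded_cluster[OF F, of "\<lambda>i p. functional p (x i)", OF bound] by blast
  have "\<Lambda> (p + q) = \<Lambda> p + \<Lambda> q" for p q
  proof (rule tendsto_unique[OF G(2) G(3)])
    show "((\<lambda>i. functional (p + q) (x i)) \<longlongrightarrow> \<Lambda> p + \<Lambda> q) G"
      using tendsto_add[OF G(3) G(3), of p q] by (simp add: functional_def cblinfun_simps)
  qed
  moreover have "\<Lambda> (a *\<^sub>C p) = a *\<^sub>C \<Lambda> p" for a p
  proof (rule tendsto_unique[OF G(2) G(3)])
    show "((\<lambda>i. functional (a *\<^sub>C p) (x i)) \<longlongrightarrow> a *\<^sub>C \<Lambda> p) G"
      using tendsto_mult_left[OF G(3), of a p] by (simp add: functional_def cblinfun_simps scaleC_complex_def)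
  qed
  ultimately obtain \<psi> where \<psi>: "\<And>p. \<psi> *\<^sub>V p = \<Lambda> p"
    using cblinfun_of_map[of \<Lambda> "K * r"] \<Lambda> by blast
  obtain z where z: "z \<in> M" "\<theta> z = inv \<Phi> \<psi>"
    using theta_bij by (metis UNIV_I bij_betw_imp_surj_on imageE)
  then have "functional p z = \<Lambda> p" for p
    using Phi_bij by (simp add: functional_def \<psi> bij_is_surj surj_f_inv_f)
  then show ?thesis using that[OF G(1,2) z(1)] G(3) by simp
qed

lemma right_compose_limit:
  assumes x: "\<And>i. x i \<in> M" and z: "z \<in> M" and a: "a \<in> M"
    and lim: "\<And>p. ((\<lambda>i. functional p (x i)) \<longlongrightarrow> functional p z) G"
  shows "((\<lambda>i. functional p (x i o\<^sub>C\<^sub>L a)) \<longlongrightarrow> functional p (z o\<^sub>C\<^sub>L a)) G"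
proof -
  have "limitin (weak_star_topology \<Phi>) (\<lambda>i. \<theta> (x i)) (\<theta> z) G"
    unfolding weak_star_topology_def limitin_weak_topology_UNIV
    using lim by (auto simp: functional_def)
  from continuous_map_limit[OF right_mult_continuous[of "\<theta> a"] this]
  have "limitin (weak_star_topology \<Phi>) (\<lambda>i. \<theta> (x i) * \<theta> a) (\<theta> z * \<theta> a) G"
    by (simp add: o_def)
  then show ?thesis
    unfolding weak_star_topology_def limitin_weak_topology_UNIV
    using x z a by (auto simp: functional_def theta_compose)
qed

section \<open>Weak-star continuous functionals are normal\<close>

text \<open>
  Every cluster point \<open>z\<close> of the net \<open>w p\<^sub>D\<close>, indexed by finite sets \<open>D\<close>, equals \<open>w\<close>: for a vector \<open>\<xi>\<close>,
  multiplication on the right by the projection of \<open>{\<xi>}\<close> makes the net eventually constant, and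
  this projection fixes \<open>\<xi>\<close>.
\<close>

lemma functional_hull_projection_near:
  assumes w: "w \<in> M" and D: "finite D" and e: "e > 0"
  obtains D' where "D \<subseteq> D'" "finite D'"
    "cmod (functional p (w o\<^sub>C\<^sub>L hull_projection M D') - functional p w) < e"
proof -
  let ?P = "hull_projection M"
  note P_M = hull_projection_mem[OF von_neumann]
  let ?F = "finite_subsets_at_top (UNIV :: 'h set)"
  have mem: "w o\<^sub>C\<^sub>L ?P D \<in> M" for D using w P_M by (rule compose_M)
  have bnd: "norm (w o\<^sub>C\<^sub>L ?P D) \<le> norm w" for D
  proof (rule norm_cblinfun_bound)
    fix h
    have "norm ((w o\<^sub>C\<^sub>L ?P D) *\<^sub>V h) \<le> norm w * norm (?P D *\<^sub>V h)" by (simp add: norm_cblinfun)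
    also have "\<dots> \<le> norm w * norm h"
      by (intro mult_left_mono norm_hull_projection_le[OF von_neumann]) simp
    finally show "norm ((w o\<^sub>C\<^sub>L ?P D) *\<^sub>V h) \<le> norm w * norm h" .
  qed simp
  obtain G z where G: "G \<le> ?F" "G \<noteq> bot" and z: "z \<in> M"
    and lim: "\<And>p. ((\<lambda>D. functional p (w o\<^sub>C\<^sub>L ?P D)) \<longlongrightarrow> functional p z) G"
    using bounded_cluster[of ?F "\<lambda>D. w o\<^sub>C\<^sub>L ?P D", OF finite_subsets_at_top_neq_bot mem bnd] by blast
  have above: "eventually (\<lambda>D'. finite D' \<and> D0 \<subseteq> D') G" if "finite D0" for D0
    by (rule filter_leD[OF G(1)]) (use that in \<open>auto simp: eventually_finite_subsets_at_top\<close>)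
  have "z *\<^sub>V \<xi> = w *\<^sub>V \<xi>" for \<xi>
  proof -
    let ?p = "?P {\<xi>}"
    have "z o\<^sub>C\<^sub>L ?p = w o\<^sub>C\<^sub>L ?p"
    proof (rule functional_separates)
      fix p
      have "((\<lambda>D. functional p ((w o\<^sub>C\<^sub>L ?P D) o\<^sub>C\<^sub>L ?p)) \<longlongrightarrow> functional p (z o\<^sub>C\<^sub>L ?p)) G"
        by (rule right_compose_limit[OF mem z P_M lim])
      moreover have "((\<lambda>D. functional p ((w o\<^sub>C\<^sub>L ?P D) o\<^sub>C\<^sub>L ?p)) \<longlongrightarrow> functional p (w o\<^sub>C\<^sub>L ?p)) G"
      proof (rule tendsto_eventually, rule eventually_mono[OF above[of "{\<xi>}"]])
        fix D assume "finite D \<and> {\<xi>} \<subseteq> D"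
        then have "?P D o\<^sub>C\<^sub>L ?p = ?p" by (intro hull_projection_absorbs[OF von_neumann]) simp
        moreover have "(w o\<^sub>C\<^sub>L ?P D) o\<^sub>C\<^sub>L ?p = w o\<^sub>C\<^sub>L (?P D o\<^sub>C\<^sub>L ?p)" by (rule cblinfun_eqI) simp
        ultimately show "functional p ((w o\<^sub>C\<^sub>L ?P D) o\<^sub>C\<^sub>L ?p) = functional p (w o\<^sub>C\<^sub>L ?p)" by simp
      qed simp
      ultimately show "functional p (z o\<^sub>C\<^sub>L ?p) = functional p (w o\<^sub>C\<^sub>L ?p)"
        by (rule tendsto_unique[OF G(2)])
    qed (use z w P_M in \<open>auto intro: compose_M\<close>)
    from arg_cong[OF this, of "\<lambda>t. t *\<^sub>V \<xi>"] show ?thesis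
      using hull_projection_fixes[OF von_neumann, of \<xi> "{\<xi>}"] annihilated_hull_superset[of "{\<xi>}" M]
      by simp
  qed
  then have "z = w" by (rule cblinfun_eqI)
  then have "eventually (\<lambda>D'. dist (functional p (w o\<^sub>C\<^sub>L ?P D')) (functional p w) < e) G"
    using tendstoD[OF lim e] by simp
  then have "eventually (\<lambda>D'. (finite D' \<and> D \<subseteq> D') \<and>
      dist (functional p (w o\<^sub>C\<^sub>L ?P D')) (functional p w) < e) G"
    by (rule eventually_conj[OF above[OF D]])
  then obtain D' where "finite D'" "D \<subseteq> D'" "dist (functional p (w o\<^sub>C\<^sub>L ?P D')) (functional p w) < e"
    using eventually_happens[of _ G] G(2) by blast
  then show ?thesis using that by (simp add: dist_norm)
qed

text \<open>
  Otherwise a recursion produces finite sets \<open>D 0 \<subseteq> D 1 \<subseteq> \<dots>\<close> and elements \<open>v n\<close>, with \<open>v n\<close> living on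
  the part of the hull of \<open>D (Suc n)\<close> orthogonal to the hull of \<open>D n\<close>, on which the functional stays
  above \<open>e / 2\<close>. By Cauchy-Schwarz and Pythagoras the sum of \<open>n\<close> of them has norm at most \<open>\<surd>n\<close>,
  which contradicts boundedness of the functional for large \<open>n\<close>.
\<close>

theorem finitely_supported_up_to:
  assumes e: "e > 0"
  obtains D where "finite D"
    "\<And>w. w \<in> M \<Longrightarrow> (\<And>\<xi>. \<xi> \<in> D \<Longrightarrow> w *\<^sub>V \<xi> = 0) \<Longrightarrow> cmod (functional p w) \<le> e * norm w"
proof (rule ccontr)
  note main = that
  assume no: "\<not> thesis"
  let ?P = "hull_projection M"
  define Q where "Q D D' \<longleftrightarrow> D \<subseteq> D' \<and>
    (\<exists>v\<in>M. (\<forall>h. norm (v *\<^sub>V h) \<le> norm (?P D' *\<^sub>V h - ?P D *\<^sub>V h)) \<and> e / 2 \<le> Re (functional p v))"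
    for D D'
  have step: "\<exists>D'. finite D' \<and> Q D D'"
    if D: "finite D" for D
  proof -
    have "\<not> (\<forall>w\<in>M. (\<forall>\<xi>\<in>D. w *\<^sub>V \<xi> = 0) \<longrightarrow> cmod (functional p w) \<le> e * norm w)"
      using no main[OF D] by blast
    then obtain w where w: "w \<in> M" "\<And>\<xi>. \<xi> \<in> D \<Longrightarrow> w *\<^sub>V \<xi> = 0" "e * norm w < cmod (functional p w)"
      by (auto simp: not_le)
    have w0: "norm w > 0" using w(3) functional_zero by (cases "w = 0") auto
    define f where "f = functional p w"
    have f0: "cmod f > 0" unfolding f_def using w(3) mult_pos_pos[OF e w0] by linarith
    \<comment> \<open>Normalise \<open>w\<close> and turn the value of the functional into a positive number.\<close>
    define u where "u = (cnj f / of_real (cmod f * norm w)) *\<^sub>C w"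
    have u: "u \<in> M" "\<And>\<xi>. \<xi> \<in> D \<Longrightarrow> u *\<^sub>V \<xi> = 0"
      using w by (auto simp: u_def scaleC_M cblinfun_simps scaleC_zero_right)
    have nu: "norm u = 1"
      using w0 f0 by (simp add: u_def norm_scaleC norm_divide norm_mult)
    have fu: "functional p u = of_real (cmod f / norm w)"
      using w0 f0 complex_norm_square[of f] w(1)
      by (simp add: u_def functional_scaleC f_def[symmetric] power2_eq_square field_simps)
    have gt: "cmod f / norm w > e" using w(3) w0 by (simp add: f_def field_simps)
    obtain D' where D': "D \<subseteq> D'" "finite D'"
      "cmod (functional p (u o\<^sub>C\<^sub>L ?P D') - functional p u) < e / 2"
      using functional_hull_projection_near[OF u(1) D, of "e / 2" p] e by auto
    \<comment> \<open>Cutting off \<open>u\<close> at the hull of \<open>D'\<close> costs at most half of the value; \<open>u\<close> kills the hull of \<open>D\<close>.\<close>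
    define v where "v = u o\<^sub>C\<^sub>L ?P D'"
    have "v \<in> M" unfolding v_def by (intro compose_M u hull_projection_mem[OF von_neumann])
    moreover have "norm (v *\<^sub>V h) \<le> norm (?P D' *\<^sub>V h - ?P D *\<^sub>V h)" for h
    proof -
      have "v *\<^sub>V h = u *\<^sub>V (?P D' *\<^sub>V h - ?P D *\<^sub>V h)"
        using hull_projection_annihilates[OF von_neumann u, of D h] by (simp add: v_def cblinfun_simps)
      then show ?thesis using norm_cblinfun[of u "?P D' *\<^sub>V h - ?P D *\<^sub>V h"] nu by simp
    qed
    moreover have "e / 2 \<le> Re (functional p v)"
      using abs_Re_le_cmod[of "functional p v - functional p u"] D'(3) gt by (simp add: v_def[symmetric] fu)
    ultimately show ?thesis using D' unfolding Q_def by blast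
  qed
  have "\<exists>D. \<forall>n. finite (D n) \<and> Q (D n) (D (Suc n))"
    by (rule dependent_nat_choice) (use step in auto)
  then obtain D where D: "\<And>n. D n \<subseteq> D (Suc n)"
    and ex: "\<And>n. \<exists>v\<in>M. (\<forall>h. norm (v *\<^sub>V h) \<le> norm (?P (D (Suc n)) *\<^sub>V h - ?P (D n) *\<^sub>V h)) \<and>
      e / 2 \<le> Re (functional p v)"
    unfolding Q_def by blast
  obtain v where v: "\<And>n. v n \<in> M"
    "\<And>n h. norm (v n *\<^sub>V h) \<le> norm (?P (D (Suc n)) *\<^sub>V h - ?P (D n) *\<^sub>V h)"
    "\<And>n. e / 2 \<le> Re (functional p (v n))"
    using ex by metis
  obtain K where K: "K \<ge> 0" "\<And>x p. x \<in> M \<Longrightarrow> cmod (functional p x) \<le> K * norm x * norm p"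
    by (rule functional_bounded) blast
  have "real n * (e / 2)\<^sup>2 \<le> (K * norm p)\<^sup>2" if n: "n > 0" for n
  proof -
    define s where "s = (\<Sum>k<n. v k)"
    have apply_s: "s *\<^sub>V h = (\<Sum>k<n. v k *\<^sub>V h)" for h
      unfolding s_def by (induction n) (auto simp: cblinfun_simps)
    have "norm (s *\<^sub>V h) \<le> sqrt n * norm h" for h
    proof (rule power2_le_imp_le)
      let ?d = "\<lambda>k. norm (?P (D (Suc k)) *\<^sub>V h - ?P (D k) *\<^sub>V h)"
      have "norm (s *\<^sub>V h) \<le> (\<Sum>k<n. ?d k * 1)"
        unfolding apply_s using v(2) by (auto intro!: order_trans[OF norm_sum] sum_mono)
      then have "(norm (s *\<^sub>V h))\<^sup>2 \<le> (\<Sum>k<n. ?d k * 1)\<^sup>2"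
        by (intro power_mono) auto
      also have "\<dots> \<le> (\<Sum>k<n. (?d k)\<^sup>2) * (\<Sum>k<n. 1\<^sup>2)"
        by (rule Cauchy_Schwarz_ineq_sum)
      also have "(\<Sum>k<n. (?d k)\<^sup>2) = (norm (?P (D n) *\<^sub>V h))\<^sup>2 - (norm (?P (D 0) *\<^sub>V h))\<^sup>2"
        unfolding hull_projection_norm_diff[OF von_neumann D] by (rule sum_lessThan_telescope)
      also have "\<dots> \<le> (norm h)\<^sup>2"
        using power_mono[OF norm_hull_projection_le[OF von_neumann, of "D n" h] norm_ge_zero, of 2]
          zero_le_power2[of "norm (?P (D 0) *\<^sub>V h)"] by linarith
      finally show "(norm (s *\<^sub>V h))\<^sup>2 \<le> (sqrt n * norm h)\<^sup>2"
        by (simp add: power_mult_distrib mult_right_mono mult.commute)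
    qed simp
    then have ns: "norm s \<le> sqrt n" by (intro norm_cblinfun_bound) auto
    have "real n * (e / 2) = (\<Sum>k<n. e / 2)" by simp
    also have "\<dots> \<le> (\<Sum>k<n. Re (functional p (v k)))" by (intro sum_mono v)
    also have "\<dots> = Re (functional p s)" by (simp add: s_def functional_sum v)
    also have "\<dots> \<le> K * norm s * norm p"
      using K(2)[of s p] complex_Re_le_cmod[of "functional p s"] by (simp add: s_def sum_M v)
    also have "\<dots> \<le> K * sqrt n * norm p" using K(1) ns by (intro mult_right_mono mult_left_mono) auto
    finally have "(real n * (e / 2))\<^sup>2 \<le> (K * sqrt n * norm p)\<^sup>2"
      using e by (intro power_mono) auto
    then have "real n * (real n * (e / 2)\<^sup>2) \<le> real n * (K * norm p)\<^sup>2"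
      by (simp add: power_mult_distrib power2_eq_square ac_simps)
    then show ?thesis using n by simp
  qed
  moreover obtain n where "real n > (K * norm p)\<^sup>2 / (e / 2)\<^sup>2" using reals_Archimedean2 by blast
  moreover have "(e / 2)\<^sup>2 > 0" using e by simp
  moreover have "n > 0" if "real n > (K * norm p)\<^sup>2 / (e / 2)\<^sup>2" for n
  proof -
    have "0 \<le> (K * norm p)\<^sup>2 / (e / 2)\<^sup>2" by simp
    then have "real n > 0" using that by linarith
    then show ?thesis by simp
  qed
  ultimately show False by (metis not_le pos_divide_less_eq)
qed

text \<open>
  The rate \<open>(1/8)\<^sup>k\<close> leaves room for the weights \<open>\<delta> 2\<^sup>k\<close>, which make \<open>x\<^sub>k a\<close> tend to zero in norm
  while \<open>(\<Sum>k. \<parallel>\<delta> 2\<^sup>k x\<^sub>k \<xi>\<parallel>\<^sup>2)\<close> stays of order \<open>\<delta>\<^sup>2\<close>, so that \<open>a\<close> almost fixes \<open>\<xi>\<close>.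
\<close>

lemma strong_null_sequence_cluster:
  assumes x: "\<And>k. x k \<in> M" and r: "\<And>k. norm (x k *\<^sub>V \<xi>) \<le> r * (1/8) ^ k"
    and z: "z \<in> M" and G: "G \<le> sequentially" "G \<noteq> bot"
    and lim: "\<And>p. ((\<lambda>k. functional p (x k)) \<longlongrightarrow> functional p z) G"
  shows "z *\<^sub>V \<xi> = 0"
proof -
  have "norm (z *\<^sub>V \<xi>) \<le> \<delta> * (norm z * 2 * r)" if \<delta>: "\<delta> > 0" for \<delta>
  proof -
    define y where "y k = (\<delta> * 2 ^ k) *\<^sub>R x k" for k
    have yM: "y k \<in> M" for k by (simp add: y_def scaleR_M x)
    obtain a where a: "a \<in> M" "\<And>k h. norm (y k *\<^sub>V (a *\<^sub>V h)) \<le> norm h"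
      "\<And>\<xi>. summable (\<lambda>k. (norm (y k *\<^sub>V \<xi>))\<^sup>2) \<Longrightarrow>
         (norm (a *\<^sub>V \<xi> - \<xi>))\<^sup>2 \<le> (\<Sum>k. (norm (y k *\<^sub>V \<xi>))\<^sup>2)"
      using compressor_exists[of M y, OF von_neumann yM] by blast
    have bound: "(norm (y k *\<^sub>V \<xi>))\<^sup>2 \<le> (\<delta> * r)\<^sup>2 * (1/2) ^ k" for k
    proof -
      have "norm (y k *\<^sub>V \<xi>) \<le> \<delta> * 2 ^ k * (r * (1/8) ^ k)"
        using \<delta> r by (simp add: y_def cblinfun_simps mult_left_mono)
      also have "\<dots> = (\<delta> * r) * (2 ^ k * (1/8) ^ k)" by (simp only: ac_simps)
      also have "2 ^ k * (1/8) ^ k = (1/4 :: real) ^ k" by (simp flip: power_mult_distrib)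
      finally have "(norm (y k *\<^sub>V \<xi>))\<^sup>2 \<le> ((\<delta> * r) * (1/4) ^ k)\<^sup>2" by (intro power_mono) auto
      also have "\<dots> = (\<delta> * r)\<^sup>2 * (1/16) ^ k"
      proof -
        have "((1/4) ^ k)\<^sup>2 = (1/16 :: real) ^ k"
          unfolding power2_eq_square power_mult_distrib[symmetric] by simp
        then show ?thesis by (simp only: power_mult_distrib)
      qed
      also have "\<dots> \<le> (\<delta> * r)\<^sup>2 * (1/2) ^ k" by (intro mult_left_mono power_mono) auto
      finally show ?thesis .
    qed
    have geo: "(\<lambda>k. (\<delta> * r)\<^sup>2 * (1/2) ^ k) sums ((\<delta> * r)\<^sup>2 * 2)"
      using sums_mult[OF geometric_sums[of "1/2 :: real"], of "(\<delta> * r)\<^sup>2"] by simp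
    have summ: "summable (\<lambda>k. (norm (y k *\<^sub>V \<xi>))\<^sup>2)"
      by (rule summable_comparison_test'[OF sums_summable[OF geo]]) (use bound in simp)
    have "(norm (a *\<^sub>V \<xi> - \<xi>))\<^sup>2 \<le> (\<delta> * r)\<^sup>2 * 2"
      using a(3)[OF summ] suminf_le[OF bound summ sums_summable[OF geo]] sums_unique[OF geo] by simp
    also have "\<dots> \<le> (2 * (\<delta> * r))\<^sup>2" by (simp add: power_mult_distrib)
    finally have near: "norm (a *\<^sub>V \<xi> - \<xi>) \<le> 2 * (\<delta> * r)"
      by (rule power2_le_imp_le) (use \<delta> order_trans[OF norm_ge_zero r[of 0]] in simp)
    have small: "norm (x k o\<^sub>C\<^sub>L a) \<le> inverse \<delta> * (1/2) ^ k" for k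
    proof (rule norm_cblinfun_bound)
      fix h
      have "\<delta> * 2 ^ k * norm (x k *\<^sub>V (a *\<^sub>V h)) \<le> norm h"
        using a(2)[of k h] \<delta> by (simp add: y_def cblinfun_simps)
      then show "norm ((x k o\<^sub>C\<^sub>L a) *\<^sub>V h) \<le> inverse \<delta> * (1/2) ^ k * norm h"
        using \<delta> by (simp add: field_simps power_divide)
    qed (use \<delta> in simp)
    have "z o\<^sub>C\<^sub>L a = 0"
    proof (rule functional_separates)
      fix p
      obtain K where K: "K \<ge> 0" "\<And>x p. x \<in> M \<Longrightarrow> cmod (functional p x) \<le> K * norm x * norm p"
        by (rule functional_bounded) blast
      have "(\<lambda>k. functional p (x k o\<^sub>C\<^sub>L a)) \<longlonglongrightarrow> 0"
      proof (rule Lim_null_comparison)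
        have "cmod (functional p (x k o\<^sub>C\<^sub>L a)) \<le> K * (inverse \<delta> * (1/2) ^ k) * norm p" for k
          using K(2)[OF compose_M[OF x a(1)]] mult_right_mono[OF mult_left_mono[OF small K(1)] norm_ge_zero]
            order_trans by blast
        then show "\<forall>\<^sub>F k in sequentially. norm (functional p (x k o\<^sub>C\<^sub>L a)) \<le> K * (inverse \<delta> * (1/2) ^ k) * norm p"
          by simp
        have "(\<lambda>k. K * (inverse \<delta> * (1/2) ^ k) * norm p) \<longlonglongrightarrow> K * (inverse \<delta> * 0) * norm p"
          by (intro tendsto_intros LIMSEQ_power_zero) simp
        then show "(\<lambda>k. K * (inverse \<delta> * (1/2) ^ k) * norm p) \<longlonglongrightarrow> 0" by simp
      qed
      then have "((\<lambda>k. functional p (x k o\<^sub>C\<^sub>L a)) \<longlongrightarrow> 0) G" by (rule tendsto_mono[OF G(1)])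
      then show "functional p (z o\<^sub>C\<^sub>L a) = functional p 0"
        using tendsto_unique[OF G(2) right_compose_limit[OF x z a(1) lim]] by (simp add: functional_zero)
    qed (use z a(1) in \<open>auto intro: compose_M zero_M\<close>)
    then have "z *\<^sub>V (a *\<^sub>V \<xi>) = 0" by (metis cblinfun_compose_apply cblinfun_zero_left)
    then have "norm (z *\<^sub>V \<xi>) = norm (z *\<^sub>V (a *\<^sub>V \<xi> - \<xi>))" by (simp add: cblinfun_simps)
    also have "\<dots> \<le> norm z * (2 * (\<delta> * r))"
      using norm_cblinfun[of z "a *\<^sub>V \<xi> - \<xi>"] mult_left_mono[OF near norm_ge_zero[of z]] by linarith
    finally show ?thesis by (simp add: ac_simps)
  qed note small = this
  have "((\<lambda>\<delta>. \<delta> * (norm z * 2 * r)) \<longlongrightarrow> 0 * (norm z * 2 * r)) (at_right 0)"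
    by (intro tendsto_intros)
  moreover have "\<forall>\<^sub>F \<delta> in at_right 0. norm (z *\<^sub>V \<xi>) \<le> \<delta> * (norm z * 2 * r)"
    using small by (auto simp: eventually_at_filter)
  ultimately have "norm (z *\<^sub>V \<xi>) \<le> 0 * (norm z * 2 * r)"
    by (intro tendsto_lowerbound) auto
  then show ?thesis by simp
qed

text \<open>
  If the estimate failed for all multiples \<open>8\<^sup>n D\<close> of a finite set \<open>D\<close> that supports the functional up
  to a small error, there would be unit vectors \<open>x n\<close> of \<open>M\<close> tending rapidly to zero on \<open>D\<close> with values
  above \<open>e\<close>. Their cluster points kill \<open>D\<close>, so the functional is small at them.
\<close>

theorem strong_estimate:
  assumes e: "e > 0"
  obtains D where "\<And>x. x \<in> M \<Longrightarrow> cmod (functional p x) \<le> e * norm x + (\<Sum>\<xi>\<leftarrow>D. norm (x *\<^sub>V \<xi>))"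
proof (rule ccontr)
  note main = that
  assume no: "\<not> thesis"
  obtain K where K: "K \<ge> 0" "\<And>x p. x \<in> M \<Longrightarrow> cmod (functional p x) \<le> K * norm x * norm p"
    by (rule functional_bounded) blast
  obtain K' where K': "K' \<ge> 0"
    "\<And>x s. x \<in> M \<Longrightarrow> s \<ge> 0 \<Longrightarrow> (\<And>p. cmod (functional p x) \<le> s * norm p) \<Longrightarrow> norm x \<le> K' * s"
    by (rule functional_bounds_norm) blast
  \<comment> \<open>Cluster points of the unit ball have norm at most \<open>K' * K\<close>, which \<open>e'\<close> has to absorb.\<close>
  define e' where "e' = e / (2 * (K' * K + 1))"
  have KK: "K' * K + 1 > 0" using K(1) K'(1) by (simp add: add_nonneg_pos)
  have e': "e' > 0" using e KK by (simp add: e'_def)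
  obtain D where D: "finite D"
    "\<And>w. w \<in> M \<Longrightarrow> (\<And>\<xi>. \<xi> \<in> D \<Longrightarrow> w *\<^sub>V \<xi> = 0) \<Longrightarrow> cmod (functional p w) \<le> e' * norm w"
    using finitely_supported_up_to[OF e', of p] by blast
  obtain ds where ds: "set ds = D" using finite_list[OF D(1)] by blast
  have "\<exists>x\<in>M. norm x = 1 \<and> e < cmod (functional p x) \<and> (\<forall>\<xi>\<in>D. norm (x *\<^sub>V \<xi>) \<le> (K * norm p) * (1/8) ^ n)" for n
  proof -
    let ?S = "\<lambda>x. \<Sum>\<xi>\<leftarrow>ds. norm (x *\<^sub>V \<xi>)"
    have "\<not> (\<forall>x\<in>M. cmod (functional p x) \<le> e * norm x + (\<Sum>\<xi>\<leftarrow>map (scaleR (8 ^ n)) ds. norm (x *\<^sub>V \<xi>)))"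
      using no main by blast
    then obtain x where x: "x \<in> M"
      and "e * norm x + (\<Sum>\<xi>\<leftarrow>map (scaleR (8 ^ n)) ds. norm (x *\<^sub>V \<xi>)) < cmod (functional p x)"
      by (auto simp: not_le)
    then have gt: "e * norm x + 8 ^ n * ?S x < cmod (functional p x)"
      by (simp add: o_def cblinfun_simps sum_list_const_mult)
    have S_nonneg: "?S x \<ge> 0" for x by (rule sum_list_nonneg) auto
    have x0: "norm x > 0" using gt S_nonneg[of 0] functional_zero by (cases "x = 0") (auto simp: cblinfun_simps)
    define u where "u = inverse (norm x) *\<^sub>R x"
    have uM: "u \<in> M" and nu: "norm u = 1" using x x0 by (auto simp: u_def scaleR_M)
    have Su: "?S u = inverse (norm x) * ?S x"
      by (simp add: u_def cblinfun_simps sum_list_const_mult)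
    have fu: "cmod (functional p u) = inverse (norm x) * cmod (functional p x)"
      by (simp add: u_def functional_scaleR x norm_mult norm_inverse)
    have gt_u: "e + 8 ^ n * ?S u < cmod (functional p u)"
    proof -
      have "e + 8 ^ n * (inverse (norm x) * ?S x) = inverse (norm x) * (e * norm x + 8 ^ n * ?S x)"
        using x0 by (simp add: field_simps)
      also have "\<dots> < inverse (norm x) * cmod (functional p x)"
        using gt x0 by (intro mult_strict_left_mono) auto
      finally show ?thesis unfolding Su fu .
    qed
    have "norm (u *\<^sub>V \<xi>) \<le> (K * norm p) * (1/8) ^ n" if "\<xi> \<in> D" for \<xi>
    proof -
      have "norm (u *\<^sub>V \<xi>) \<le> ?S u"
        using that ds by (intro member_le_sum_list) auto
      moreover have "8 ^ n * ?S u \<le> K * norm p"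
        using gt_u e K(2)[OF uM, of p] nu by simp
      ultimately have "8 ^ n * norm (u *\<^sub>V \<xi>) \<le> K * norm p"
        by (meson mult_left_mono order_trans zero_le_numeral zero_le_power)
      then show ?thesis by (simp add: field_simps power_divide)
    qed
    moreover have "e < cmod (functional p u)"
      using gt_u mult_nonneg_nonneg[OF _ S_nonneg[of u], of "8 ^ n"] by simp
    ultimately show ?thesis using uM nu by blast
  qed
  then obtain x where x: "\<And>n. x n \<in> M" "\<And>n. norm (x n) = 1" "\<And>n. e < cmod (functional p (x n))"
    "\<And>n \<xi>. \<xi> \<in> D \<Longrightarrow> norm (x n *\<^sub>V \<xi>) \<le> (K * norm p) * (1/8) ^ n"
    by metis
  obtain G z where G: "G \<le> sequentially" "G \<noteq> bot" and z: "z \<in> M"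
    and lim: "\<And>p. ((\<lambda>n. functional p (x n)) \<longlongrightarrow> functional p z) G"
    using bounded_cluster[of sequentially x 1] x(1,2) by auto
  have "z *\<^sub>V \<xi> = 0" if "\<xi> \<in> D" for \<xi>
    by (rule strong_null_sequence_cluster[OF x(1) x(4)[OF that] z G lim])
  then have upper: "cmod (functional p z) \<le> e' * norm z" by (rule D(2)[OF z])
  have "cmod (functional q z) \<le> K * norm q" for q
  proof (rule tendsto_upperbound[OF tendsto_norm[OF lim] _ G(2)])
    show "\<forall>\<^sub>F n in G. norm (functional q (x n)) \<le> K * norm q"
      using K(2)[OF x(1), of q] x(2) by simp
  qed
  then have "norm z \<le> K' * K" by (rule K'(2)[OF z K(1)])
  then have "cmod (functional p z) \<le> e' * (K' * K + 1)"
    using upper e' by (smt (verit) mult_left_mono)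
  also have "\<dots> = e / 2"
  proof -
    have "e / (2 * c) * c = e / 2" if "c > 0" for c :: real using that by simp
    from this[OF KK] show ?thesis unfolding e'_def .
  qed
  finally have "cmod (functional p z) \<le> e / 2" .
  moreover have "e \<le> cmod (functional p z)"
    by (rule tendsto_lowerbound[OF tendsto_norm[OF lim] _ G(2)]) (use less_imp_le[OF x(3)] in simp)
  ultimately show False using e by simp
qed

theorem functional_in_vn_predual: "functional p \<in> vn_predual M"
proof (rule vn_predualI[OF von_neumann])
  fix e :: real assume e: "e > 0"
  obtain D where "\<And>x. x \<in> M \<Longrightarrow> cmod (functional p x) \<le> e * norm x + (\<Sum>\<xi>\<leftarrow>D. norm (x *\<^sub>V \<xi>))"
    using strong_estimate[OF e] by blast
  then show "\<exists>L. \<forall>x\<in>M. cmod (functional p x - vector_sum L x) \<le> e * norm x"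
    using e by (intro approximation_by_vector_sum[OF star_M]) (auto simp: functional_add functional_scaleC)
qed

end

theorem theorem5p2:
  fixes M :: "('h::complex_hilbert \<Rightarrow>\<^sub>C\<^sub>L 'h) set"
    and \<Phi> :: "'b::complex_banach_algebra \<Rightarrow> ('p::complex_banach \<Rightarrow>\<^sub>C\<^sub>L complex)"
    and \<theta> :: "('h \<Rightarrow>\<^sub>C\<^sub>L 'h) \<Rightarrow> 'b"
  assumes "von_neumann_algebra M"
    and "dual_banach_algebra \<Phi>"
    and "banach_algebra_isomorphism M \<theta>"
  shows "continuous_map (weak_topology M (vn_predual M)) (weak_star_topology \<Phi>) \<theta>"
proof -
  interpret dual_isomorphism M \<Phi> \<theta> by (rule dual_isomorphism.intro) (fact assms)+
  let ?X = "weak_topology M (vn_predual M)"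
  have top: "topspace ?X = M"
    unfolding weak_topology_def topology_generated_by_topspace by auto
  show ?thesis
    unfolding weak_star_topology_def weak_topology_def[of UNIV]
  proof (rule continuous_on_generated_topo)
    fix U assume "U \<in> insert UNIV {f -` U \<inter> UNIV |f U. f \<in> range (\<lambda>p b. \<Phi> b *\<^sub>V p) \<and> open U}"
    then consider "U = UNIV" | p V where "U = (\<lambda>b. \<Phi> b *\<^sub>V p) -` V" "open V" by auto
    then show "openin ?X (\<theta> -` U \<inter> topspace ?X)"
    proof cases
      case 1
      then show ?thesis by simp
    next
      case (2 p V)
      then have "\<theta> -` U \<inter> topspace ?X = functional p -` V \<inter> M"
        unfolding top by (auto simp: functional_def)
      moreover have "openin ?X (functional p -` V \<inter> M)"
        unfolding weak_topology_def using functional_in_vn_predual 2(2)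
        by (intro topology_generated_by_Basis) blast
      ultimately show ?thesis by simp
    qed
  qed auto
qed

end
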